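(* Let $X$ be a nonempty compact metric space, $m\in\mathbb{N}$ and $G$ a commutative group of homeomorphisms of $X$. (a) Let $\{T_1^w\}_{w\in\widetilde L(\Sigma,\vec k)},\ldots,\{T_m^w\}_{w\in\widetilde L(\Sigma,\vec k)}$ be $m$ $\widetilde L(\Sigma,\vec k)$-systems of transformations of $X$, all contained in $G$, and let $\vec w\in\widetilde L^\infty(\Sigma,\vec k;\upsilon)$. Then there exist $x_0\in X$ and an extraction $\vec u\prec\vec w$ such that $R_1\text{-}\lim_{w\in\widetilde E(\vec u)}T_i^w(x_0)=x_0$ for every $1\le i\le m$. Moreover, in case $(X,G)$ is minimal, the set of such points $x_0$ is a dense subset of $X$. (b) Let $\{T_1^w\}_{w\in L(\Sigma,\vec k)},\ldots,\{T_m^w\}_{w\in L(\Sigma,\vec k)}$ be $m$ $L(\Sigma,\vec k)$-systems of transformations of $X$, all contained in $G$, and let $\vec w\in L^\infty(\Sigma,\vec k;\upsilon)$. Then there exist $x_0\in X$ and an extraction $\vec u\prec\vec w$ such that $R_2\text{-}\lim_{w\in E(\vec u)}T_i^w(x_0)=x_0$ for every $1\le i\le m$. Moreover, in case $(X,G)$ is minimal, the set of such points $x_0$ is a dense subset of $X$.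
   Context: Notation: $\mathbb{N}=\{1,2,\ldots\}$, $\mathbb{Z}^\ast=\mathbb{Z}\setminus\{0\}$. $\Sigma=\{\alpha_n:n\in\mathbb{Z}^\ast\}$ is an alphabet (letters need not be distinct), $\vec k=(k_n)_{n\in\mathbb{Z}^\ast}\subseteq\mathbb{N}$ with $(k_n)_{n\in\mathbb{N}}$ and $(k_{-n})_{n\in\mathbb{N}}$ increasing in the weak sense (constant sequences allowed), and $\upsilon\notin\Sigma$ is a variable. $(X,G)$ is minimal if no nonempty proper closed subset of $X$ is invariant under $G$. "Such points $x_0$" are the points for which some $\vec u\prec\vec w$ (depending on $x_0$) satisfies the stated limits. Two-sided words. $\widetilde L(\Sigma,\vec k)$ is the set of functions $w$ from a nonempty finite set $dom(w)\subset\mathbb{Z}^\ast$ to $\Sigma$ with $w(n)\in\{\alpha_1,\ldots,\alpha_{k_n}\}$ for $n\in dom(w)$, $n>0$, and $w(n)\in\{\alpha_{-k_n},\ldots,\alpha_{-1}\}$ for $n\in dom(w)$, $n<0$. A variable word is a function $w$ from a nonempty finite $dom(w)\subset\mathbb{Z}^\ast$ to $\Sigma\cup\{\upsilon\}$ such that, for each $n\in dom(w)$, $w(n)\in\{\upsilon,\alpha_1,\ldots,\alpha_{k_n}\}$ if $n>0$ and $w(n)\in\{\upsilon,\alpha_{-k_n},\ldots,\alpha_{-1}\}$ if $n<0$, and $\upsilon$ is attained. $dom^-(w)$, $dom^+(w)$ are the sets of negative, respectively positive, elements of $dom(w)$. $\widetilde L_0(\Sigma,\vec k;\upsilon)$ is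 the set of variable words taking the value $\upsilon$ at some negative and at some positive position. For words $w,u$ (variable or not) with disjoint domains, $w\star u$ is the word with domain $dom(w)\cup dom(u)$ extending both. $w<_{R_1}u$ means $dom(u)=A_1\cup A_2$ with $A_1,A_2\ne\emptyset$ and $\max A_1<\min dom(w)\le\max dom(w)<\min A_2$. $\widetilde L^\infty(\Sigma,\vec k;\upsilon)$ is the set of sequences $(w_n)_{n\in\mathbb{N}}$ in $\widetilde L_0(\Sigma,\vec k;\upsilon)$ with $w_n<_{R_1}w_{n+1}$ for all $n$. Substitution: for $w\in\widetilde L_0(\Sigma,\vec k;\upsilon)$ with $n_w=\min dom^+(w)$, $-m_w=\max dom^-(w)$, and $1\le p\le k_{n_w}$, $1\le q\le k_{-m_w}$, $w(p,q)$ is obtained from $w$ by replacing $\upsilon$ by $\alpha_p$ at positive positions and by $\alpha_{-q}$ at negative positions; $w(\upsilon,\upsilon)=w$. Extractions: for $\vec w=(w_n)\in\widetilde L^\infty(\Sigma,\vec k;\upsilon)$, $\widetilde E(\vec w)$ is the set of words $w_{n_1}(p_1,q_1)\star\cdots\star w_{n_\lambda}(p_\lambda,q_\lambda)$ with $\lambda\in\mathbb{N}$, $n_1<\cdots<n_\lambda$ in $\mathbb{N}$, $(p_i,q_i)\in\{1,\ldots,k_{n_i}\}\times\{1,\ldots,k_{-n_i}\}$. $\widetilde{EV}(\vec w)$ is the set of words of the same form where $(p_i,q_i)\in(\{1,\ldots,k_{n_i}\}\times\{1,\ldots,k_{-n_i}\})\cup\{(\upsilon,\upsilon)\}$ and at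 least one $(p_i,q_i)=(\upsilon,\upsilon)$. $\vec u\prec\vec w$ ("$\vec u$ is an extraction of $\vec w$") means $\vec u\in\widetilde L^\infty(\Sigma,\vec k;\upsilon)$ and $u_n\in\widetilde{EV}(\vec w)$ for all $n$. One-sided words. $L(\Sigma,\vec k)$ is the set of $w\in\widetilde L(\Sigma,\vec k)$ with $dom(w)\subset\mathbb{N}$; $L(\Sigma,\vec k;\upsilon)$ is the set of variable words with domain in $\mathbb{N}$. $w<_{R_2}u$ means $\max dom(w)<\min dom(u)$. $L^\infty(\Sigma,\vec k;\upsilon)$ is the set of sequences $(w_n)_{n\in\mathbb{N}}$ in $L(\Sigma,\vec k;\upsilon)$ with $w_n<_{R_2}w_{n+1}$. For $1\le p\le k_{\min dom(w)}$, $w(p)$ is $w$ with $\upsilon$ replaced by $\alpha_p$; $w(\upsilon)=w$. $E(\vec w)$ is the set of words $w_{n_1}(p_1)\star\cdots\star w_{n_\lambda}(p_\lambda)$ with $n_1<\cdots<n_\lambda$, $1\le p_i\le k_{n_i}$; $EV(\vec w)$ is the same with $p_i\in\{1,\ldots,k_{n_i}\}\cup\{\upsilon\}$ and some $p_i=\upsilon$. $\vec u\prec\vec w$ means $\vec u\in L^\infty(\Sigma,\vec k;\upsilon)$ and $u_n\in EV(\vec w)$ for all $n$. Convergence. $R_1\text{-}\lim_{w\in\widetilde E(\vec u)}x_w=x_0$ means: for every neighborhood $V$ of $x_0$ there is $n_0\in\mathbb{N}$ with $x_w\in V$ for all $w\in\widetilde E(\vec u)$ with $\min\{-\max dom^-(w),\min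 dom^+(w)\}\ge n_0$. $R_2\text{-}\lim_{w\in E(\vec u)}x_w=x_0$ means the same with $w\in E(\vec u)$ and $\min dom(w)\ge n_0$. Systems. An $\widetilde L(\Sigma,\vec k)$-system (resp. $L(\Sigma,\vec k)$-system) of $X$ is a family $\{T^w\}$ of continuous maps $X\to X$ indexed by $w\in\widetilde L(\Sigma,\vec k)$ (resp. $w\in L(\Sigma,\vec k)$) with $T^{w_1}T^{w_2}=T^{w_1\star w_2}$ whenever $w_1<_{R_1}w_2$ (resp. $w_1<_{R_2}w_2$). *)

theory Defs
  imports "HOL-Analysis.Analysis" "HOL-Algebra.Bij"
begin

section \<open>Words\<close>

text \<open>
  A word is a finite partial map on the nonzero integers with values in an ambient type of symbols
  that contains the letters \<open>\<alpha> n\<close>, for \<open>n \<noteq> 0\<close>, and the variable \<open>\<upsilon>\<close>; the value \<open>\<alpha> 0\<close> is never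
  used. The concatenation of words with disjoint domains is the library's map union \<open>++\<close>.
  Sequences are indexed by the positive naturals: their value at \<open>0\<close> is never inspected.
\<close>

type_synonym 'a word = "int \<Rightarrow> 'a option"

definition letters :: "(int \<Rightarrow> 'a) \<Rightarrow> (int \<Rightarrow> nat) \<Rightarrow> int \<Rightarrow> 'a set" where
  "letters \<alpha> k n = (if n > 0 then \<alpha> ` {1..int (k n)} else \<alpha> ` {- int (k n)..-1})"

definition words2 :: "(int \<Rightarrow> 'a) \<Rightarrow> (int \<Rightarrow> nat) \<Rightarrow> 'a word set" where
  "words2 \<alpha> k = {w. finite (dom w) \<and> dom w \<noteq> {} \<and> 0 \<notin> dom w \<and>
     (\<forall>n\<in>dom w. the (w n) \<in> letters \<alpha> k n)}"

definition var_words :: "(int \<Rightarrow> 'a) \<Rightarrow> (int \<Rightarrow> nat) \<Rightarrow> 'a \<Rightarrow> 'a word set" where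
  "var_words \<alpha> k \<upsilon> = {w. finite (dom w) \<and> dom w \<noteq> {} \<and> 0 \<notin> dom w \<and>
     (\<forall>n\<in>dom w. the (w n) \<in> insert \<upsilon> (letters \<alpha> k n)) \<and> \<upsilon> \<in> ran w}"

definition dom_neg :: "'a word \<Rightarrow> int set" where
  "dom_neg w = {n \<in> dom w. n < 0}"

definition dom_pos :: "'a word \<Rightarrow> int set" where
  "dom_pos w = {n \<in> dom w. n > 0}"

definition star_list :: "'a word list \<Rightarrow> 'a word" where
  "star_list ws = foldr (++) ws Map.empty"


subsection \<open>Two-sided words\<close>

definition var_words2 :: "(int \<Rightarrow> 'a) \<Rightarrow> (int \<Rightarrow> nat) \<Rightarrow> 'a \<Rightarrow> 'a word set" where
  "var_words2 \<alpha> k \<upsilon> = {w \<in> var_words \<alpha> k \<upsilon>.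
     (\<exists>n<0. w n = Some \<upsilon>) \<and> (\<exists>n>0. w n = Some \<upsilon>)}"

definition less_R1 :: "'a word \<Rightarrow> 'a word \<Rightarrow> bool" where
  "less_R1 w u \<longleftrightarrow> (\<exists>A1 A2. dom u = A1 \<union> A2 \<and> A1 \<noteq> {} \<and> A2 \<noteq> {} \<and>
     Max A1 < Min (dom w) \<and> Min (dom w) \<le> Max (dom w) \<and> Max (dom w) < Min A2)"

definition var_seqs2 :: "(int \<Rightarrow> 'a) \<Rightarrow> (int \<Rightarrow> nat) \<Rightarrow> 'a \<Rightarrow> (nat \<Rightarrow> 'a word) set" where
  "var_seqs2 \<alpha> k \<upsilon> = {ws. \<forall>n\<ge>1. ws n \<in> var_words2 \<alpha> k \<upsilon> \<and> less_R1 (ws n) (ws (Suc n))}"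

definition subst2 :: "(int \<Rightarrow> 'a) \<Rightarrow> 'a \<Rightarrow> 'a word \<Rightarrow> nat \<Rightarrow> nat \<Rightarrow> 'a word" where
  "subst2 \<alpha> \<upsilon> w p q = (\<lambda>n. if w n = Some \<upsilon> then Some (if n > 0 then \<alpha> (int p) else \<alpha> (- int q))
     else w n)"

text \<open>The choice \<open>None\<close> stands for \<open>(\<upsilon>, \<upsilon>)\<close>, that is, for leaving the variable in place.\<close>

definition inst2 :: "(int \<Rightarrow> 'a) \<Rightarrow> 'a \<Rightarrow> 'a word \<Rightarrow> (nat \<times> nat) option \<Rightarrow> 'a word" where
  "inst2 \<alpha> \<upsilon> w c = (case c of None \<Rightarrow> w | Some (p, q) \<Rightarrow> subst2 \<alpha> \<upsilon> w p q)"

text \<open>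
  In the extractions, \<open>ns\<close> is the list \<open>n\<^sub>1 < \<dots> < n\<^sub>\<lambda>\<close>. As these indices are distinct, the choices
  \<open>(p\<^sub>i, q\<^sub>i)\<close> are given as functions of \<open>n\<^sub>i\<close> instead of \<open>i\<close>.
\<close>

definition extr2 ::
  "(int \<Rightarrow> 'a) \<Rightarrow> (int \<Rightarrow> nat) \<Rightarrow> 'a \<Rightarrow> (nat \<Rightarrow> 'a word) \<Rightarrow> 'a word set" where
  "extr2 \<alpha> k \<upsilon> ws = {star_list (map (\<lambda>j. subst2 \<alpha> \<upsilon> (ws j) (p j) (q j)) ns) | ns p q.
     ns \<noteq> [] \<and> sorted_wrt (<) ns \<and>
     (\<forall>j\<in>set ns. j \<ge> 1 \<and> p j \<in> {1..k (int j)} \<and> q j \<in> {1..k (- int j)})}"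

definition var_extr2 ::
  "(int \<Rightarrow> 'a) \<Rightarrow> (int \<Rightarrow> nat) \<Rightarrow> 'a \<Rightarrow> (nat \<Rightarrow> 'a word) \<Rightarrow> 'a word set" where
  "var_extr2 \<alpha> k \<upsilon> ws = {star_list (map (\<lambda>j. inst2 \<alpha> \<upsilon> (ws j) (c j)) ns) | ns c.
     ns \<noteq> [] \<and> sorted_wrt (<) ns \<and>
     (\<forall>j\<in>set ns. j \<ge> 1 \<and> c j \<in> insert None (Some ` ({1..k (int j)} \<times> {1..k (- int j)}))) \<and>
     (\<exists>j\<in>set ns. c j = None)}"

definition extraction2 ::
  "(int \<Rightarrow> 'a) \<Rightarrow> (int \<Rightarrow> nat) \<Rightarrow> 'a \<Rightarrow> (nat \<Rightarrow> 'a word) \<Rightarrow> (nat \<Rightarrow> 'a word) \<Rightarrow> bool" where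
  "extraction2 \<alpha> k \<upsilon> us ws \<longleftrightarrow>
     us \<in> var_seqs2 \<alpha> k \<upsilon> \<and> (\<forall>n\<ge>1. us n \<in> var_extr2 \<alpha> k \<upsilon> ws)"


subsection \<open>One-sided words\<close>

definition words1 :: "(int \<Rightarrow> 'a) \<Rightarrow> (int \<Rightarrow> nat) \<Rightarrow> 'a word set" where
  "words1 \<alpha> k = {w \<in> words2 \<alpha> k. dom w \<subseteq> {1..}}"

definition var_words1 :: "(int \<Rightarrow> 'a) \<Rightarrow> (int \<Rightarrow> nat) \<Rightarrow> 'a \<Rightarrow> 'a word set" where
  "var_words1 \<alpha> k \<upsilon> = {w \<in> var_words \<alpha> k \<upsilon>. dom w \<subseteq> {1..}}"

definition less_R2 :: "'a word \<Rightarrow> 'a word \<Rightarrow> bool" where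
  "less_R2 w u \<longleftrightarrow> Max (dom w) < Min (dom u)"

definition var_seqs1 :: "(int \<Rightarrow> 'a) \<Rightarrow> (int \<Rightarrow> nat) \<Rightarrow> 'a \<Rightarrow> (nat \<Rightarrow> 'a word) set" where
  "var_seqs1 \<alpha> k \<upsilon> = {ws. \<forall>n\<ge>1. ws n \<in> var_words1 \<alpha> k \<upsilon> \<and> less_R2 (ws n) (ws (Suc n))}"

definition subst1 :: "(int \<Rightarrow> 'a) \<Rightarrow> 'a \<Rightarrow> 'a word \<Rightarrow> nat \<Rightarrow> 'a word" where
  "subst1 \<alpha> \<upsilon> w p = (\<lambda>n. if w n = Some \<upsilon> then Some (\<alpha> (int p)) else w n)"

definition inst1 :: "(int \<Rightarrow> 'a) \<Rightarrow> 'a \<Rightarrow> 'a word \<Rightarrow> nat option \<Rightarrow> 'a word" where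
  "inst1 \<alpha> \<upsilon> w c = (case c of None \<Rightarrow> w | Some p \<Rightarrow> subst1 \<alpha> \<upsilon> w p)"

definition extr1 ::
  "(int \<Rightarrow> 'a) \<Rightarrow> (int \<Rightarrow> nat) \<Rightarrow> 'a \<Rightarrow> (nat \<Rightarrow> 'a word) \<Rightarrow> 'a word set" where
  "extr1 \<alpha> k \<upsilon> ws = {star_list (map (\<lambda>j. subst1 \<alpha> \<upsilon> (ws j) (p j)) ns) | ns p.
     ns \<noteq> [] \<and> sorted_wrt (<) ns \<and> (\<forall>j\<in>set ns. j \<ge> 1 \<and> p j \<in> {1..k (int j)})}"

definition var_extr1 ::
  "(int \<Rightarrow> 'a) \<Rightarrow> (int \<Rightarrow> nat) \<Rightarrow> 'a \<Rightarrow> (nat \<Rightarrow> 'a word) \<Rightarrow> 'a word set" where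
  "var_extr1 \<alpha> k \<upsilon> ws = {star_list (map (\<lambda>j. inst1 \<alpha> \<upsilon> (ws j) (c j)) ns) | ns c.
     ns \<noteq> [] \<and> sorted_wrt (<) ns \<and>
     (\<forall>j\<in>set ns. j \<ge> 1 \<and> c j \<in> insert None (Some ` {1..k (int j)})) \<and>
     (\<exists>j\<in>set ns. c j = None)}"

definition extraction1 ::
  "(int \<Rightarrow> 'a) \<Rightarrow> (int \<Rightarrow> nat) \<Rightarrow> 'a \<Rightarrow> (nat \<Rightarrow> 'a word) \<Rightarrow> (nat \<Rightarrow> 'a word) \<Rightarrow> bool" where
  "extraction1 \<alpha> k \<upsilon> us ws \<longleftrightarrow>
     us \<in> var_seqs1 \<alpha> k \<upsilon> \<and> (\<forall>n\<ge>1. us n \<in> var_extr1 \<alpha> k \<upsilon> ws)"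


section \<open>Convergence\<close>

text \<open>\<open>R1_lim S x x0\<close> and \<open>R2_lim S x x0\<close> are the limits along \<open>w \<in> S\<close>, for a set \<open>S\<close> of words.\<close>

definition R1_lim ::
  "'a word set \<Rightarrow> ('a word \<Rightarrow> 'x::topological_space) \<Rightarrow> 'x \<Rightarrow> bool" where
  "R1_lim S x x0 \<longleftrightarrow> (\<forall>V. open V \<and> x0 \<in> V \<longrightarrow> (\<exists>n0::nat. n0 \<ge> 1 \<and>
     (\<forall>w\<in>S. min (- Max (dom_neg w)) (Min (dom_pos w)) \<ge> int n0 \<longrightarrow> x w \<in> V)))"

definition R2_lim ::
  "'a word set \<Rightarrow> ('a word \<Rightarrow> 'x::topological_space) \<Rightarrow> 'x \<Rightarrow> bool" where
  "R2_lim S x x0 \<longleftrightarrow> (\<forall>V. open V \<and> x0 \<in> V \<longrightarrow> (\<exists>n0::nat. n0 \<ge> 1 \<and>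
     (\<forall>w\<in>S. Min (dom w) \<ge> int n0 \<longrightarrow> x w \<in> V)))"


section \<open>Systems\<close>

definition system2 ::
  "(int \<Rightarrow> 'a) \<Rightarrow> (int \<Rightarrow> nat) \<Rightarrow> 'x::topological_space set \<Rightarrow> ('a word \<Rightarrow> 'x \<Rightarrow> 'x) \<Rightarrow> bool" where
  "system2 \<alpha> k X T \<longleftrightarrow>
     (\<forall>w\<in>words2 \<alpha> k. continuous_on X (T w) \<and> T w ` X \<subseteq> X) \<and>
     (\<forall>w1\<in>words2 \<alpha> k. \<forall>w2\<in>words2 \<alpha> k. less_R1 w1 w2 \<longrightarrow>
        (\<forall>x\<in>X. T w1 (T w2 x) = T (w1 ++ w2) x))"

definition system1 ::
  "(int \<Rightarrow> 'a) \<Rightarrow> (int \<Rightarrow> nat) \<Rightarrow> 'x::topological_space set \<Rightarrow> ('a word \<Rightarrow> 'x \<Rightarrow> 'x) \<Rightarrow> bool" where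
  "system1 \<alpha> k X T \<longleftrightarrow>
     (\<forall>w\<in>words1 \<alpha> k. continuous_on X (T w) \<and> T w ` X \<subseteq> X) \<and>
     (\<forall>w1\<in>words1 \<alpha> k. \<forall>w2\<in>words1 \<alpha> k. less_R2 w1 w2 \<longrightarrow>
        (\<forall>x\<in>X. T w1 (T w2 x) = T (w1 ++ w2) x))"

text \<open>
  Members of \<open>BijGroup X\<close> are the bijections of \<open>X\<close>, extended by \<open>undefined\<close> outside \<open>X\<close> so that
  a map on \<open>X\<close> is represented by exactly one function.
\<close>

definition comm_homeo_group :: "'x::topological_space set \<Rightarrow> ('x \<Rightarrow> 'x) set \<Rightarrow> bool" where
  "comm_homeo_group X G \<longleftrightarrow>
     subgroup G (BijGroup X) \<and> comm_group ((BijGroup X)\<lparr>carrier := G\<rparr>) \<and>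
     (\<forall>g\<in>G. \<exists>h. homeomorphism X X g h)"

definition minimal_action :: "'x::topological_space set \<Rightarrow> ('x \<Rightarrow> 'x) set \<Rightarrow> bool" where
  "minimal_action X G \<longleftrightarrow>
     \<not> (\<exists>C. closedin (top_of_set X) C \<and> C \<noteq> {} \<and> C \<noteq> X \<and> (\<forall>g\<in>G. g ` C \<subseteq> C))"

end

theory Submission
  imports Defs
begin

text \<open>
  All maps lie in one commutative group, so it suffices to extract from \<open>ws\<close> words in which no
  variable is replaced: \<open>us n\<close> is the concatenation of the \<open>ws j\<close> for \<open>j\<close> in a finite block
  \<open>D n \<subseteq> {n..}\<close>. On a minimal subset, the Furstenberg--Weiss argument shows that for finitely many
  families of group elements indexed by naturals and any nonempty open set, the products of the
  families over a suitable common block return some point of the set to the set. At stage \<open>n\<close> there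
  are only finitely many families, one for each of the \<open>m\<close> systems and each admissible substitution
  with index \<open>n\<close>. Hence shrinking neighbourhoods and blocks can be chosen inductively so that every
  product over the \<open>n\<close>-th block maps the next neighbourhood into the current one, and the point
  common to all neighbourhoods is recurrent. Starting from an arbitrary open set gives density.
\<close>

section \<open>Recurrence in minimal commutative actions\<close>

lemma continuous_maps_nhd:
  fixes h :: "'s \<Rightarrow> 'x::metric_space \<Rightarrow> 'y::topological_space"
  assumes "finite S" "z \<in> Y"
    and "\<And>s. s \<in> S \<Longrightarrow> continuous_on Y (h s)" "\<And>s. s \<in> S \<Longrightarrow> open (U s)" "\<And>s. s \<in> S \<Longrightarrow> h s z \<in> U s"
  obtains d where "d > 0" "\<And>v s. v \<in> Y \<Longrightarrow> dist z v < d \<Longrightarrow> s \<in> S \<Longrightarrow> h s v \<in> U s"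
proof -
  have "\<forall>s\<in>S. \<forall>\<^sub>F v in at z within Y. h s v \<in> U s"
    using assms by (metis continuous_on topological_tendstoD)
  then have "\<forall>\<^sub>F v in at z within Y. \<forall>s\<in>S. h s v \<in> U s"
    using \<open>finite S\<close> by (simp add: eventually_ball_finite)
  then obtain d where "d > 0" and d: "\<And>v. v \<in> Y \<Longrightarrow> v \<noteq> z \<Longrightarrow> dist v z < d \<Longrightarrow> \<forall>s\<in>S. h s v \<in> U s"
    by (auto simp: eventually_at)
  show thesis
    \<comment> \<open>The filter \<open>at z within Y\<close> says nothing about \<open>z\<close>
      itself; that point is covered by \<open>h s z \<in> U s\<close>.\<close>
    using that[OF \<open>d > 0\<close>] d assms(5) by (metis dist_commute)
qed

text \<open>A finite nonempty subfamily of a chain contains its own intersection, so the finite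
  intersection property holds and compactness applies.\<close>

lemma Inter_chain_nonempty:
  fixes X :: "'x::t2_space set"
  assumes "compact X" "\<And>C. C \<in> \<F> \<Longrightarrow> closed C \<and> C \<subseteq> X \<and> C \<noteq> {}"
    and "\<And>A B. A \<in> \<F> \<Longrightarrow> B \<in> \<F> \<Longrightarrow> A \<subseteq> B \<or> B \<subseteq> A" and "\<F> \<noteq> {}"
  shows "\<Inter>\<F> \<noteq> {}"
proof -
  have "X \<inter> \<Inter>\<F> \<noteq> {}"
  proof (rule compact_imp_fip[OF assms(1)])
    fix \<F>' assume F': "finite \<F>'" "\<F>' \<subseteq> \<F>"
    show "X \<inter> \<Inter>\<F>' \<noteq> {}"
    proof (cases "\<F>' = {}")
      case True
      then show ?thesis using assms(2,4) by fastforce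
    next
      case False
      have "\<Inter>\<F>' \<in> \<F>'"
      proof (rule finite_Inf_in[OF F'(1) False])
        show "inf A B \<in> \<F>'" if "A \<in> \<F>'" "B \<in> \<F>'" for A B
          using assms(3)[of A B] F'(2) that by (metis Int_absorb1 Int_absorb2 inf_commute subsetD)
      qed
      then have "\<Inter>\<F>' \<in> \<F>" using F'(2) by blast
      from assms(2)[OF this] show ?thesis by auto
    qed
  qed (use assms(2) in auto)
  then show ?thesis by blast
qed

text \<open>Zorn's lemma on the nonempty closed invariant subsets of \<open>X\<close>: by
  compactness the intersection of a chain of them is again one of them.\<close>

lemma exists_minimal_invariant:
  fixes X :: "'x::t2_space set"
  assumes "compact X" "X \<noteq> {}" "\<And>g. g \<in> G \<Longrightarrow> g ` X \<subseteq> X"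
  obtains Y where "Y \<subseteq> X" "compact Y" "Y \<noteq> {}" "\<And>g. g \<in> G \<Longrightarrow> g ` Y \<subseteq> Y"
    "\<And>C. closed C \<Longrightarrow> C \<noteq> {} \<Longrightarrow> C \<subseteq> Y \<Longrightarrow> (\<And>g. g \<in> G \<Longrightarrow> g ` C \<subseteq> C) \<Longrightarrow> C = Y"
proof -
  define I where "I = {C. closed C \<and> C \<noteq> {} \<and> C \<subseteq> X \<and> (\<forall>g\<in>G. g ` C \<subseteq> C)}"
  have I_compact: "compact C" if "C \<in> I" for C
    using that assms(1) compact_Int_closed[of X C] by (auto simp: I_def Int_absorb1)
  have "X \<in> I"
    using assms by (simp add: I_def compact_imp_closed)
  \<comment> \<open>\<open>subset_Zorn\<close> yields maximal sets, so it is applied to complements;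
    a maximal complement belongs to a minimal invariant set.\<close>
  have "\<exists>M\<in>uminus ` I. \<forall>A\<in>uminus ` I. M \<subseteq> A \<longrightarrow> A = M"
  proof (rule subset_Zorn)
    fix \<C> assume "subset.chain (uminus ` I) \<C>"
    then have sub: "\<C> \<subseteq> uminus ` I" and lin: "\<And>A B. A \<in> \<C> \<Longrightarrow> B \<in> \<C> \<Longrightarrow> A \<subseteq> B \<or> B \<subseteq> A"
      by (auto simp: subset_chain_def)
    show "\<exists>A\<in>uminus ` I. \<forall>B\<in>\<C>. B \<subseteq> A"
    proof (cases "\<C> = {}")
      case True
      then show ?thesis using \<open>X \<in> I\<close> by blast
    next
      case False
      let ?F = "uminus ` \<C>"
      have F: "?F \<subseteq> I" using sub by auto
      have "\<Inter>?F \<noteq> {}"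
      proof (rule Inter_chain_nonempty[OF assms(1)])
        show "closed C \<and> C \<subseteq> X \<and> C \<noteq> {}" if "C \<in> ?F" for C using F that by (auto simp: I_def)
        show "A \<subseteq> B \<or> B \<subseteq> A" if "A \<in> ?F" "B \<in> ?F" for A B using lin that by blast
      qed (use False in simp)
      moreover have "closed (\<Inter>?F)" using F by (auto simp: I_def)
      moreover have "\<Inter>?F \<subseteq> X"
      proof -
        obtain C where "C \<in> ?F" using False by blast
        then have "\<Inter>?F \<subseteq> C" "C \<subseteq> X" using F by (auto simp: I_def)
        then show ?thesis by (rule subset_trans)
      qed
      moreover have "g ` \<Inter>?F \<subseteq> \<Inter>?F" if "g \<in> G" for g
      proof (rule Inter_greatest)
        fix C assume C: "C \<in> ?F"
        with F have "C \<in> I" by blast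
        then have "g ` C \<subseteq> C" using that by (simp add: I_def)
        moreover have "\<Inter>?F \<subseteq> C" using C by (rule Inter_lower)
        ultimately show "g ` \<Inter>?F \<subseteq> C" by blast
      qed
      ultimately have "\<Inter>?F \<in> I"
        unfolding I_def mem_Collect_eq by (intro conjI ballI)
      then have "- \<Inter>?F \<in> uminus ` I" by (rule imageI)
      moreover have "B \<subseteq> - \<Inter>?F" if "B \<in> \<C>" for B
        using that by blast
      ultimately show ?thesis by blast
    qed
  qed
  then obtain Y where "Y \<in> I" and Y: "\<forall>A\<in>uminus ` I. - Y \<subseteq> A \<longrightarrow> A = - Y"
    by (elim bexE imageE) simp
  show thesis
  proof (rule that)
    show "C = Y" if "closed C" "C \<noteq> {}" "C \<subseteq> Y" "\<And>g. g \<in> G \<Longrightarrow> g ` C \<subseteq> C" for C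
    proof -
      have "C \<in> I" using that \<open>Y \<in> I\<close> subset_trans[OF that(3), of X] by (simp add: I_def)
      then have "- C = - Y" using Y that(3) by (metis Compl_subset_Compl_iff image_eqI)
      then show ?thesis by simp
    qed
  qed (use \<open>Y \<in> I\<close> I_compact in \<open>auto simp: I_def\<close>)
qed

section \<open>Multiple recurrence for minimal commutative actions\<close>

text \<open>The members of \<open>G\<close> may be functions on a space larger than
  \<open>Y\<close>, so the group laws are stated pointwise on \<open>Y\<close>. Minimality takes the
  form that every orbit is dense.\<close>

locale minimal_comm_action =
  fixes Y :: "'x::metric_space set" and G :: "('x \<Rightarrow> 'x) set"
  assumes compact: "compact Y" and nonempty: "Y \<noteq> {}"
    and maps: "g \<in> G \<Longrightarrow> y \<in> Y \<Longrightarrow> g y \<in> Y"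
    and cont: "g \<in> G \<Longrightarrow> continuous_on Y g"
    and comm: "g \<in> G \<Longrightarrow> h \<in> G \<Longrightarrow> y \<in> Y \<Longrightarrow> g (h y) = h (g y)"
    and comp: "g \<in> G \<Longrightarrow> h \<in> G \<Longrightarrow> \<exists>f\<in>G. \<forall>y\<in>Y. f y = g (h y)"
    and inv: "g \<in> G \<Longrightarrow> \<exists>h\<in>G. \<forall>y\<in>Y. h (g y) = y"
    and minimal: "y \<in> Y \<Longrightarrow> open U \<Longrightarrow> U \<inter> Y \<noteq> {} \<Longrightarrow> \<exists>g\<in>G. g y \<in> U"
begin

lemma foldr_maps:
  "\<forall>j\<in>set D. t j \<in> G \<Longrightarrow> y \<in> Y \<Longrightarrow> foldr t D y \<in> Y"
  by (induction D) (auto simp: maps)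

lemma foldr_cont:
  "\<forall>j\<in>set D. t j \<in> G \<Longrightarrow> continuous_on Y (foldr t D)"
proof (induction D)
  case Nil
  then show ?case by (simp add: id_def)
next
  case (Cons j D)
  have D: "\<forall>j\<in>set D. t j \<in> G" using Cons.prems by simp
  have "foldr t D ` Y \<subseteq> Y" using foldr_maps[OF D] by blast
  moreover have "continuous_on Y (t j)" using Cons.prems cont by simp
  ultimately have "continuous_on Y (\<lambda>y. t j (foldr t D y))"
    using Cons.IH[OF D] by (metis continuous_on_compose2)
  then show ?case by (simp add: comp_def)
qed

lemma foldr_comm:
  "\<forall>j\<in>set D. t j \<in> G \<Longrightarrow> g \<in> G \<Longrightarrow> y \<in> Y \<Longrightarrow> g (foldr t D y) = foldr t D (g y)"
proof (induction D)
  case (Cons j D)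
  have "g (t j (foldr t D y)) = t j (g (foldr t D y))"
    by (rule comm) (use Cons.prems foldr_maps in auto)
  also have "g (foldr t D y) = foldr t D (g y)"
    using Cons by simp
  finally show ?case by simp
qed simp

text \<open>\<open>foldr t D\<close> is the product of the maps \<open>t j\<close> over the block
  \<open>D\<close>, the last index acting first. By commutativity each \<open>u j\<close> moves
  inwards past the product of the \<open>t\<close>, which splits a product of composites.\<close>

lemma foldr_comp:
  assumes "\<forall>j\<in>set D. t j \<in> G \<and> u j \<in> G" "\<forall>j\<in>set D. \<forall>y\<in>Y. v j y = t j (u j y)" "y \<in> Y"
  shows "foldr v D y = foldr t D (foldr u D y)"
  using assms(1,2)
proof (induction D)
  case (Cons j D)
  have "foldr v (j # D) y = t j (u j (foldr t D (foldr u D y)))"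
    using Cons \<open>y \<in> Y\<close> by (simp add: foldr_maps)
  also have "\<dots> = t j (foldr t D (u j (foldr u D y)))"
    using Cons \<open>y \<in> Y\<close> by (simp add: foldr_maps foldr_comm)
  finally show ?case by simp
qed simp

text \<open>By minimality the preimages of \<open>U\<close> under members of \<open>G\<close> cover
  \<open>Y\<close>; a finite subcover provides \<open>F\<close>.\<close>

lemma finite_return_set:
  assumes "open U" "U \<inter> Y \<noteq> {}"
  obtains F where "finite F" "F \<subseteq> G" "\<And>y. y \<in> Y \<Longrightarrow> \<exists>f\<in>F. f y \<in> U"
proof -
  have "\<exists>A. open A \<and> A \<inter> Y = g -` U \<inter> Y" if "g \<in> G" for g
    using cont[OF that] \<open>open U\<close> by (auto simp: continuous_on_open_invariant)
  then obtain A where A: "\<And>g. g \<in> G \<Longrightarrow> open (A g) \<and> A g \<inter> Y = g -` U \<inter> Y"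
    by metis
  have "Y \<subseteq> (\<Union>g\<in>G. A g)"
    using minimal[OF _ assms] A by fastforce
  then obtain F where "F \<subseteq> G" "finite F" "Y \<subseteq> (\<Union>g\<in>F. A g)"
    using compactE_image[OF compact, of G A] A by metis
  moreover from this have "\<exists>f\<in>F. f y \<in> U" if "y \<in> Y" for y
    using that A by blast
  ultimately show thesis using that by blast
qed

text \<open>
  Induction step: with \<open>r s j = t s j \<circ> inverse (t s0 j)\<close>, the induction hypothesis for \<open>r\<close> yields a
  block and a smaller open set that all \<open>t s\<close>, including \<open>t s0\<close>, map along the block into a given
  open set. Iterating gives open sets \<open>V\<close> each moved into \<open>U\<close> by one of finitely many group elements
  \<open>f\<close>; two of them share \<open>f\<close>, and the concatenation of the blocks in between returns \<open>f v\<close> to \<open>U\<close>.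
\<close>

lemma multiple_recurrence:
  assumes "finite S" "\<forall>s\<in>S. \<forall>j\<ge>N. t s j \<in> G" "open U" "U \<inter> Y \<noteq> {}"
  shows "\<exists>D y. D \<noteq> [] \<and> sorted_wrt (<) D \<and> set D \<subseteq> {N::nat..} \<and> y \<in> U \<inter> Y \<and> (\<forall>s\<in>S. foldr (t s) D y \<in> U)"
  using assms
proof (induction S arbitrary: t N U rule: finite_induct)
  case empty
  then obtain y where "y \<in> U \<inter> Y" by blast
  then show ?case by (intro exI[of _ "[N]"] exI[of _ y]) auto
next
  case (insert s0 S)
  let ?S = "insert s0 S"
  obtain F where F: "finite F" "F \<subseteq> G" "\<And>y. y \<in> Y \<Longrightarrow> \<exists>f\<in>F. f y \<in> U"
    using finite_return_set insert.prems by metis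
  have "\<forall>j. \<exists>h. j \<ge> N \<longrightarrow> h \<in> G \<and> (\<forall>y\<in>Y. h (t s0 j y) = y)"
    by (metis inv insert.prems(1) insertI1)
  then obtain h where h: "\<And>j. j \<ge> N \<Longrightarrow> h j \<in> G \<and> (\<forall>y\<in>Y. h j (t s0 j y) = y)"
    by metis
  \<comment> \<open>The left inverse \<open>h j\<close> is also a right inverse, by
    commutativity.\<close>
  have th: "t s0 j (h j y) = y" if "j \<ge> N" "y \<in> Y" for j y
    by (metis comm h insert.prems(1) insertI1 that)
  have "\<forall>s j. \<exists>r. s \<in> S \<and> j \<ge> N \<longrightarrow> r \<in> G \<and> (\<forall>y\<in>Y. r y = t s j (h j y))"
    by (metis comp h insert.prems(1) insertI2)
  then obtain r where r: "\<And>s j. s \<in> S \<Longrightarrow> j \<ge> N \<Longrightarrow> r s j \<in> G \<and> (\<forall>y\<in>Y. r s j y = t s j (h j y))"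
    by metis
  \<comment> \<open>The starting point \<open>y\<close> may lie outside \<open>V\<close>: it is the
    image, under the product of the \<open>h j\<close>, of the point \<open>z\<close> that the
    induction hypothesis finds in \<open>V\<close>.\<close>
  have step: "\<exists>D y. D \<noteq> [] \<and> sorted_wrt (<) D \<and> set D \<subseteq> {M..} \<and> y \<in> Y \<and> (\<forall>s\<in>?S. foldr (t s) D y \<in> V)"
    if "open V" "V \<inter> Y \<noteq> {}" "M \<ge> N" for V M
  proof -
    have "\<forall>s\<in>S. \<forall>j\<ge>M. r s j \<in> G" using r \<open>M \<ge> N\<close> by auto
    from insert.IH[OF this that(1,2)] obtain D z where D: "D \<noteq> []" "sorted_wrt (<) D" "set D \<subseteq> {M..}"
      and z: "z \<in> V \<inter> Y" "\<forall>s\<in>S. foldr (r s) D z \<in> V" by blast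
    have DN: "j \<ge> N" if "j \<in> set D" for j using D(3) \<open>M \<ge> N\<close> that by auto
    have hD: "foldr h D z \<in> Y" by (rule foldr_maps) (use h DN z(1) in auto)
    \<comment> \<open>For \<open>s0\<close> the quotient family is the identity, so the product of
      the \<open>t s0 j\<close> undoes that of the \<open>h j\<close> and leads back to
      \<open>z \<in> V\<close>.\<close>
    have "foldr (t s0) D (foldr h D z) = foldr (\<lambda>_. id) D z"
    proof (rule foldr_comp[symmetric])
      show "\<forall>j\<in>set D. t s0 j \<in> G \<and> h j \<in> G" using DN h insert.prems(1) by blast
      show "\<forall>j\<in>set D. \<forall>y\<in>Y. id y = t s0 j (h j y)" using DN th by simp
    qed (use z in simp)
    also have "\<dots> = z" by (induction D) auto
    finally have "foldr (t s0) D (foldr h D z) \<in> V" using z by simp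
    moreover have "foldr (t s) D (foldr h D z) \<in> V" if "s \<in> S" for s
    proof -
      have "foldr (r s) D z = foldr (t s) D (foldr h D z)"
      proof (rule foldr_comp)
        show "\<forall>j\<in>set D. t s j \<in> G \<and> h j \<in> G" using DN h insert.prems(1) that by blast
        show "\<forall>j\<in>set D. \<forall>y\<in>Y. r s j y = t s j (h j y)" using DN r that by blast
      qed (use z in simp)
      then show ?thesis using z that by metis
    qed
    ultimately show ?thesis using D hD by blast
  qed
  \<comment> \<open>A state consists of an open set \<open>V\<close>, a lower bound \<open>M\<close>
    for the indices of the next block, and a member \<open>f\<close> of \<open>F\<close> taking
    \<open>V \<inter> Y\<close> into \<open>U\<close>. \<open>Q\<close> says that some block between
    the two bounds moves the later set into the earlier one.\<close>
  define P where "P = (\<lambda>(V, M, f). open V \<and> V \<inter> Y \<noteq> {} \<and> M \<ge> N \<and> f \<in> F \<and> (\<forall>v\<in>V \<inter> Y. f v \<in> U))"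
  define Q where "Q = (\<lambda>(V, M::nat, f::'x \<Rightarrow> 'x) (V', M', f'::'x \<Rightarrow> 'x). \<exists>E. E \<noteq> [] \<and> sorted_wrt (<) E \<and>
    set E \<subseteq> {M..<M'} \<and> (\<forall>s\<in>?S. \<forall>v\<in>V' \<inter> Y. foldr (t s) E v \<in> V))"
  \<comment> \<open>Nothing is asked of the third component of \<open>x\<close>, so this also starts
    the sequence, from \<open>UNIV\<close> and \<open>N\<close>. The new set is a ball around the
    point given by \<open>step\<close>, small enough for both the block and \<open>f'\<close> by
    continuity.\<close>
  have refine: "\<exists>y. P y \<and> Q x y"
    if x: "x = (V, M, f)" and V: "open V" "V \<inter> Y \<noteq> {}" and "M \<ge> N" for x V M f
  proof -
    from step[OF V \<open>M \<ge> N\<close>] obtain D y where D: "D \<noteq> []" "sorted_wrt (<) D" "set D \<subseteq> {M..}"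
      and y: "y \<in> Y" "\<forall>s\<in>?S. foldr (t s) D y \<in> V" by metis
    have tG: "\<forall>j\<in>set D. t s j \<in> G" if "s \<in> ?S" for s
    proof
      fix j assume "j \<in> set D"
      then have "j \<ge> N" using D(3) \<open>M \<ge> N\<close> by auto
      then show "t s j \<in> G" using insert.prems(1) that by blast
    qed
    obtain f' where f': "f' \<in> F" "f' y \<in> U" using F y(1) by blast
    have "finite ?S" using insert.hyps by simp
    then obtain d where d: "d > 0" "\<And>v s. v \<in> Y \<Longrightarrow> dist y v < d \<Longrightarrow> s \<in> ?S \<Longrightarrow> foldr (t s) D v \<in> V"
      using continuous_maps_nhd[of ?S y Y "\<lambda>s. foldr (t s) D" "\<lambda>_. V", OF _ y(1) foldr_cont[OF tG] V(1)]
        y(2) by metis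
    obtain d' where d': "d' > 0" "\<And>v. v \<in> Y \<Longrightarrow> dist y v < d' \<Longrightarrow> f' v \<in> U"
      using continuous_maps_nhd[of "{()}" y Y "\<lambda>_. f'" "\<lambda>_. U", OF _ y(1) cont[of f'] insert.prems(2)]
        f' F(2) by auto
    have yb: "ball y (min d d') \<inter> Y \<noteq> {}"
      using centre_in_ball[of y "min d d'"] y(1) d(1) d'(1) by (metis IntI empty_iff min_less_iff_conj)
    have "Max (set D) \<ge> N" using D \<open>M \<ge> N\<close>
      by (metis List.finite_set Max_in atLeast_iff le_trans set_empty subsetD)
    then have "P (ball y (min d d'), Suc (Max (set D)), f')"
      unfolding P_def prod.case using yb d'(2) f'(1) by auto
    moreover have "Q x (ball y (min d d'), Suc (Max (set D)), f')"
      unfolding Q_def x using D d(2) by (auto simp: less_Suc_eq_le intro!: exI[of _ D])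
    ultimately show ?thesis by blast
  qed
  obtain x0 where "P x0"
    using refine[OF refl open_UNIV _ order.refl] nonempty by (metis Int_UNIV_left)
  moreover have "\<exists>y. P y \<and> Q x y" if "P x" for x
  proof -
    obtain V M f where x: "x = (V, M, f)" by (cases x)
    then have "open V" "V \<inter> Y \<noteq> {}" "M \<ge> N" using that by (auto simp: P_def)
    then show ?thesis using refine[OF x] by blast
  qed
  ultimately obtain x where Px: "\<And>n. P (x n)" and Qx: "\<And>n. Q (x n) (x (Suc n))"
    using dependent_nat_choice[of "\<lambda>_. P" "\<lambda>_. Q"] by metis
  \<comment> \<open>Blocks are concatenated. \<open>P b\<close> gives \<open>Mb \<ge> N\<close>, so
    the maps along \<open>E2\<close> lie in \<open>G\<close> and the intermediate point stays in
    \<open>Y\<close>, as the property of \<open>E1\<close> requires.\<close>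
  have Q_trans: "Q a c" if ab: "Q a b" and bc: "Q b c" and "P b" for a b c
  proof -
    obtain Va Ma fa Vb Mb fb Vc Mc fc where abc: "a = (Va, Ma, fa)" "b = (Vb, Mb, fb)" "c = (Vc, Mc, fc)"
      by (metis prod.exhaust)
    obtain E1 where E1: "E1 \<noteq> []" "sorted_wrt (<) E1" "set E1 \<subseteq> {Ma..<Mb}"
      "\<forall>s\<in>?S. \<forall>v\<in>Vb \<inter> Y. foldr (t s) E1 v \<in> Va"
      using ab unfolding Q_def abc prod.case by blast
    obtain E2 where E2: "E2 \<noteq> []" "sorted_wrt (<) E2" "set E2 \<subseteq> {Mb..<Mc}"
      "\<forall>s\<in>?S. \<forall>v\<in>Vc \<inter> Y. foldr (t s) E2 v \<in> Vb"
      using bc unfolding Q_def abc prod.case by blast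
    have "Ma \<le> Mb"
      using E1(1,3) by (cases E1) auto
    have "Mb \<le> Mc"
      using E2(1,3) by (cases E2) auto
    have "Mb \<ge> N" using \<open>P b\<close> by (simp add: P_def abc)
    have "sorted_wrt (<) (E1 @ E2)"
      using E1(2,3) E2(2,3) by (fastforce simp: sorted_wrt_append)
    moreover have "set (E1 @ E2) \<subseteq> {Ma..<Mc}"
      using E1(3) E2(3) \<open>Ma \<le> Mb\<close> \<open>Mb \<le> Mc\<close> by fastforce
    moreover have "foldr (t s) (E1 @ E2) v \<in> Va" if "s \<in> ?S" "v \<in> Vc \<inter> Y" for s v
    proof -
      have "\<forall>j\<in>set E2. t s j \<in> G"
        using E2(3) \<open>Mb \<ge> N\<close> insert.prems(1) that(1) by (meson atLeastLessThan_iff order.trans subsetD)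
      then have "foldr (t s) E2 v \<in> Vb \<inter> Y"
        using E2(4) that foldr_maps by blast
      then have "foldr (t s) E1 (foldr (t s) E2 v) \<in> Va"
        using E1(4) that(1) by blast
      then show ?thesis by simp
    qed
    ultimately show ?thesis
      using E1(1) unfolding abc Q_def prod.case by (intro exI[of _ "E1 @ E2"]) simp
  qed
  have Q_less: "Q (x a) (x b)" if "a < b" for a b
    using that
  proof (induction b)
    case (Suc b)
    then show ?case
      using Qx Q_trans Px by (cases "a = b") auto
  qed simp
  \<comment> \<open>Pigeonhole: infinitely many states carry elements of the finite set
    \<open>F\<close>, so two of them carry the same one.\<close>
  have "range (\<lambda>n. snd (snd (x n))) \<subseteq> F"
    using Px by (auto simp: P_def split_def)
  then have "\<not> inj (\<lambda>n. snd (snd (x n)))"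
    using F(1) finite_imageD finite_subset infinite_UNIV_nat by metis
  then obtain p q where pq: "p \<noteq> q" "snd (snd (x p)) = snd (snd (x q))"
    by (auto simp: inj_def)
  obtain a b where "a < b" and fab: "snd (snd (x a)) = snd (snd (x b))"
  proof (cases "p < q")
    case False
    then show thesis using pq that[of q p] by simp
  qed (use pq that in blast)
  obtain V M f V' M' where ab: "x a = (V, M, f)" "x b = (V', M', f)"
    using fab by (metis prod.collapse)
  obtain E where E: "E \<noteq> []" "sorted_wrt (<) E" "set E \<subseteq> {M..<M'}"
    "\<forall>s\<in>?S. \<forall>v\<in>V' \<inter> Y. foldr (t s) E v \<in> V"
    using Q_less[OF \<open>a < b\<close>] unfolding Q_def ab prod.case by blast
  have a: "M \<ge> N" "f \<in> G" "\<forall>v\<in>V \<inter> Y. f v \<in> U"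
    using Px[of a] F by (auto simp: P_def ab)
  have tG: "\<forall>j\<in>set E. t s j \<in> G" if "s \<in> ?S" for s
    using E(3) a(1) insert.prems(1) that by (meson atLeastLessThan_iff order.trans subsetD)
  obtain v where v: "v \<in> V' \<inter> Y" "f v \<in> U"
    using Px[of b] by (auto simp: P_def ab)
  have "foldr (t s) E (f v) \<in> U" if "s \<in> ?S" for s
  proof -
    have "foldr (t s) E v \<in> V \<inter> Y" using foldr_maps[OF tG[OF that]] E(4) v(1) that by blast
    then have "f (foldr (t s) E v) \<in> U" using a(3) by blast
    then show ?thesis using foldr_comm[OF tG[OF that] a(2), of v] v(1) by auto
  qed
  moreover have "set E \<subseteq> {N..}" using E a by auto
  ultimately show ?case
    using E(1,2) v maps[OF a(2), of v] by blast
qed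

text \<open>
  The sets \<open>Y \<inter> cball (y n) (r n)\<close> decrease, and the block \<open>D n\<close> sends the \<open>Suc n\<close>-th of them into
  the \<open>n\<close>-th one for every choice of \<open>s \<in> S n\<close>. So the blocks of a product, applied to the common
  point \<open>x0\<close> from the innermost one outwards, never leave the set belonging to the smallest index.
\<close>

lemma recurrent_point:
  assumes "\<And>n. finite (S n)" "\<And>n s j. s \<in> S n \<Longrightarrow> n \<le> j \<Longrightarrow> t s j \<in> G" "open U" "U \<inter> Y \<noteq> {}"
  obtains x0 D where "x0 \<in> U \<inter> Y" "\<And>n. D n \<noteq> []" "\<And>n. sorted_wrt (<) (D n)" "\<And>n. set (D n) \<subseteq> {n::nat..}"
    "\<And>n i j. i \<in> set (D n) \<Longrightarrow> j \<in> set (D (Suc n)) \<Longrightarrow> i < j"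
    "\<And>e. e > 0 \<Longrightarrow> \<exists>N. \<forall>ns s. sorted_wrt (<) ns \<and> set ns \<subseteq> {N..} \<and> (\<forall>n\<in>set ns. s n \<in> S n) \<longrightarrow>
       dist (foldr (\<lambda>n. foldr (t (s n)) (D n)) ns x0) x0 < e"
proof -
  \<comment> \<open>The triple is a centre, a radius and a lower bound for the indices of block
    \<open>n\<close>. The bound \<open>1 / Suc n\<close> makes the diameters tend to zero, and
    \<open>M \<ge> n\<close> puts the block into \<open>{n..}\<close>.\<close>
  define P where "P = (\<lambda>n (y, r, M). y \<in> Y \<and> r > 0 \<and> r \<le> 1 / Suc n \<and> M \<ge> n \<and> cball y r \<inter> Y \<subseteq> U)"
  define Q where "Q = (\<lambda>n (y, r::real, M) (y', r', M'). cball y' r' \<inter> Y \<subseteq> cball y r \<and>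
    (\<exists>D. D \<noteq> [] \<and> sorted_wrt (<) D \<and> set D \<subseteq> {M..<M'} \<and>
      (\<forall>s\<in>S n. \<forall>v\<in>cball y' r' \<inter> Y. foldr (t s) D v \<in> cball y r)))"
  have "\<exists>x. P 0 x"
  proof -
    obtain y where y: "y \<in> U" "y \<in> Y" using assms(4) by blast
    obtain r where r: "r > 0" "cball y r \<subseteq> U" using assms(3) y(1) open_contains_cball by blast
    have "cball y (min r 1) \<subseteq> cball y r" by auto
    then have "P 0 (y, min r 1, 0)" using r y by (auto simp: P_def)
    then show ?thesis by blast
  qed
  moreover have "\<exists>x'. P (Suc n) x' \<and> Q n x x'" if "P n x" for n x
  proof -
    obtain y r M where x: "x = (y, r, M)" by (cases x)
    have y: "y \<in> Y" "r > 0" "M \<ge> n" "cball y r \<inter> Y \<subseteq> U" using that by (auto simp: P_def x)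
    have tG: "t s j \<in> G" if "s \<in> S n" "j \<ge> M" for s j
      using assms(2)[OF that(1)] that(2) y(3) by simp
    have "y \<in> ball y r \<inter> Y" using y by simp
    then have "ball y r \<inter> Y \<noteq> {}" by blast
    \<comment> \<open>Recurrence needs an open set, the common point needs closed ones: the open
      ball is used here, and a closed ball around \<open>z\<close> is then fitted inside.\<close>
    then obtain D z where D: "D \<noteq> []" "sorted_wrt (<) D" "set D \<subseteq> {M..}"
      and z: "z \<in> ball y r \<inter> Y" "\<forall>s\<in>S n. foldr (t s) D z \<in> ball y r"
      using multiple_recurrence[of "S n" M t "ball y r"] assms(1) tG by auto
    have "continuous_on Y (foldr (t s) D)" if "s \<in> S n" for s
      using foldr_cont tG[OF that] D(3) by (metis atLeast_iff subsetD)
    then obtain d where d: "d > 0" "\<And>v s. v \<in> Y \<Longrightarrow> dist z v < d \<Longrightarrow> s \<in> S n \<Longrightarrow> foldr (t s) D v \<in> ball y r"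
      using continuous_maps_nhd[of "S n" z Y "\<lambda>s. foldr (t s) D" "\<lambda>_. ball y r"] assms(1) z by auto
    have zr: "dist y z < r" using z(1) by simp
    \<comment> \<open>The three bounds give, in turn, the required rate of shrinking, validity of
      the continuity estimate on the closed ball (whence \<open>d / 2\<close>), and nesting in
      \<open>cball y r\<close>.\<close>
    define r' where "r' = min (1 / Suc (Suc n)) (min (d / 2) (r - dist y z))"
    have r': "r' > 0" "r' \<le> 1 / Suc (Suc n)" "r' < d" "r' \<le> r - dist y z"
      using d(1) zr by (auto simp: r'_def min_def)
    have sub: "cball z r' \<subseteq> cball y r"
    proof
      fix v assume "v \<in> cball z r'"
      then show "v \<in> cball y r" using r'(4) dist_triangle[of y v z] by simp
    qed
    define M' where "M' = Suc (Max (set D))"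
    have DM: "set D \<subseteq> {M..<M'}" using D(3) by (auto simp: M'_def less_Suc_eq_le)
    then have "M' \<ge> Suc n" using D(1) y(3) by (cases D) auto
    then have "P (Suc n) (z, r', M')"
      using z(1) r' sub y(4) unfolding P_def prod.case by blast
    moreover have "foldr (t s) D v \<in> cball y r" if "s \<in> S n" "v \<in> cball z r' \<inter> Y" for s v
      using d(2)[of v s] that r'(3) by auto
    then have "Q n x (z, r', M')"
      using D DM sub unfolding Q_def prod.case x by blast
    ultimately show ?thesis by blast
  qed
  ultimately obtain x where Px: "\<And>n. P n (x n)" and Qx: "\<And>n. Q n (x n) (x (Suc n))"
    using dependent_nat_choice[of P Q] by metis
  define K where "K n = Y \<inter> cball (fst (x n)) (fst (snd (x n)))" for n
  define M where "M n = snd (snd (x n))" for n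
  have K: "closed (K n)" "K n \<subseteq> Y" "K n \<noteq> {}" "K n \<subseteq> U" "M n \<ge> n"
    and K_dist: "u \<in> K n \<Longrightarrow> v \<in> K n \<Longrightarrow> dist u v \<le> 2 / Suc n" for n u v
  proof -
    obtain y r N where x: "x n = (y, r, N)" by (cases "x n")
    have p: "y \<in> Y" "r > 0" "r \<le> 1 / Suc n" "N \<ge> n" "cball y r \<inter> Y \<subseteq> U"
      using Px[of n] by (auto simp: P_def x)
    show "closed (K n)" using compact compact_imp_closed by (auto simp: K_def)
    show "K n \<subseteq> Y" "K n \<subseteq> U" "M n \<ge> n" using p by (auto simp: K_def M_def x)
    have "y \<in> K n" using p by (simp add: K_def x)
    then show "K n \<noteq> {}" by blast
    show "dist u v \<le> 2 / Suc n" if "u \<in> K n" "v \<in> K n"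
    proof -
      have "dist y u \<le> 1 / Suc n" "dist y v \<le> 1 / Suc n" using that p(3) by (auto simp: K_def x)
      then have "dist u v \<le> 1 / Suc n + 1 / Suc n" using dist_triangle3[of u v y] by linarith
      then show ?thesis by simp
    qed
  qed
  have "\<exists>D. D \<noteq> [] \<and> sorted_wrt (<) D \<and> set D \<subseteq> {M n..<M (Suc n)} \<and>
      (\<forall>s\<in>S n. \<forall>v\<in>K (Suc n). foldr (t s) D v \<in> K n)" and K_Suc: "K (Suc n) \<subseteq> K n" for n
  proof -
    obtain y r N y' r' N' where x: "x n = (y, r, N)" "x (Suc n) = (y', r', N')"
      by (metis prod.exhaust)
    show "K (Suc n) \<subseteq> K n" using Qx[of n] by (auto simp: Q_def K_def x)
    obtain D where D: "D \<noteq> []" "sorted_wrt (<) D" "set D \<subseteq> {N..<N'}"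
      "\<forall>s\<in>S n. \<forall>v\<in>cball y' r' \<inter> Y. foldr (t s) D v \<in> cball y r"
      using Qx[of n] unfolding Q_def x prod.case by blast
    have "N \<ge> n" using K(5)[of n] by (simp add: M_def x)
    have "foldr (t s) D v \<in> K n" if "s \<in> S n" "v \<in> K (Suc n)" for s v
    proof -
      have "\<forall>j\<in>set D. t s j \<in> G"
        using assms(2)[OF that(1)] D(3) \<open>N \<ge> n\<close> by (meson atLeastLessThan_iff order.trans subsetD)
      then have "foldr (t s) D v \<in> Y" using foldr_maps that(2) K(2) by blast
      then show ?thesis using D(4) that by (auto simp: K_def x)
    qed
    then show "\<exists>D. D \<noteq> [] \<and> sorted_wrt (<) D \<and> set D \<subseteq> {M n..<M (Suc n)} \<and>
      (\<forall>s\<in>S n. \<forall>v\<in>K (Suc n). foldr (t s) D v \<in> K n)"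
      using D(1-3) by (auto simp: M_def x)
  qed
  then obtain D where D: "\<And>n. D n \<noteq> []" "\<And>n. sorted_wrt (<) (D n)" "\<And>n. set (D n) \<subseteq> {M n..<M (Suc n)}"
    "\<And>n s v. s \<in> S n \<Longrightarrow> v \<in> K (Suc n) \<Longrightarrow> foldr (t s) (D n) v \<in> K n"
    by metis
  have K_mono: "K n \<subseteq> K m" if "m \<le> n" for m n
    by (rule lift_Suc_antimono_le[of K]) (use K_Suc that in auto)
  have "\<Inter>(range K) \<noteq> {}"
  proof (rule Inter_chain_nonempty[OF compact])
    show "A \<subseteq> B \<or> B \<subseteq> A" if "A \<in> range K" "B \<in> range K" for A B
      using that K_mono by (metis imageE nat_le_linear)
  qed (use K in auto)
  then obtain x0 where x0: "\<And>n. x0 \<in> K n" by blast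
  have fold_K: "foldr (\<lambda>n. foldr (t (s n)) (D n)) ns x0 \<in> K N"
    if "sorted_wrt (<) ns" "set ns \<subseteq> {N..}" "\<forall>n\<in>set ns. s n \<in> S n" for ns N s
    using that
  proof (induction ns arbitrary: N)
    case (Cons n ns)
    \<comment> \<open>All indices in the tail exceed \<open>n\<close>, so the induction hypothesis
      is used with \<open>Suc n\<close> for \<open>N\<close>.\<close>
    have "foldr (\<lambda>n. foldr (t (s n)) (D n)) ns x0 \<in> K (Suc n)"
      using Cons.prems by (intro Cons.IH) auto
    then have "foldr (\<lambda>n. foldr (t (s n)) (D n)) (n # ns) x0 \<in> K n"
      using D(4) Cons.prems(3) by simp
    then show ?case using K_mono[of N n] Cons.prems(2) by auto
  qed (use x0 in simp)
  show thesis
  proof (rule that[of x0 D])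
    show "x0 \<in> U \<inter> Y" using x0 K by blast
    show "set (D n) \<subseteq> {n..}" for n
      using D(3)[of n] K(5)[of n] by (meson atLeastLessThan_iff atLeast_iff order.trans subsetD subsetI)
    show "i < j" if "i \<in> set (D n)" "j \<in> set (D (Suc n))" for n i j
      using that D(3) by (meson atLeastLessThan_iff order.strict_trans2 subsetD)
    show "\<exists>N. \<forall>ns s. sorted_wrt (<) ns \<and> set ns \<subseteq> {N..} \<and> (\<forall>n\<in>set ns. s n \<in> S n) \<longrightarrow>
       dist (foldr (\<lambda>n. foldr (t (s n)) (D n)) ns x0) x0 < e" if "e > 0" for e
    proof -
      \<comment> \<open>The product and \<open>x0\<close> both lie in \<open>K N\<close>, whose
        diameter is at most \<open>2 / Suc N\<close>.\<close>
      obtain N where "N > 0" "inverse (of_nat N) < e / 2"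
        using ex_inverse_of_nat_less[of "e / 2"] \<open>e > 0\<close> by auto
      then have "2 / real N < e" by (simp add: field_simps)
      moreover have "2 / Suc N \<le> 2 / real N" using \<open>N > 0\<close> by (simp add: frac_le)
      ultimately have "2 / Suc N < e" by linarith
      then show ?thesis
        using fold_K K_dist[OF _ x0, of _ N] by (intro exI[of _ N]) (meson le_less_trans)
    qed
  qed (use D in auto)
qed

end

section \<open>Groups of homeomorphisms as minimal actions\<close>

text \<open>The closure of an orbit in \<open>Y\<close> is closed, nonempty and invariant, hence all
  of \<open>Y\<close> by \<open>min\<close>; this is the density of orbits. The group laws are read
  off from \<open>BijGroup X\<close>.\<close>

lemma minimal_comm_actionI:
  fixes X :: "'x::metric_space set"
  assumes G: "comm_homeo_group X G" and "Y \<subseteq> X" "compact Y" "Y \<noteq> {}"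
    and inv: "\<And>g. g \<in> G \<Longrightarrow> g ` Y \<subseteq> Y"
    and min: "\<And>C. closed C \<Longrightarrow> C \<noteq> {} \<Longrightarrow> C \<subseteq> Y \<Longrightarrow> (\<And>g. g \<in> G \<Longrightarrow> g ` C \<subseteq> C) \<Longrightarrow> C = Y"
  shows "minimal_comm_action Y G"
proof -
  interpret subgroup G "BijGroup X"
    using G by (simp add: comm_homeo_group_def)
  interpret C: comm_group "(BijGroup X)\<lparr>carrier := G\<rparr>"
    using G by (simp add: comm_homeo_group_def)
  interpret B: group "BijGroup X"
    by (rule group_BijGroup)
  have Bij: "g \<in> Bij X" if "g \<in> G" for g
    using that subset by (auto simp: BijGroup_def)
  have mult: "g \<otimes>\<^bsub>BijGroup X\<^esub> h = compose X g h" if "g \<in> G" "h \<in> G" for g h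
    using Bij that by (simp add: BijGroup_def)
  have maps: "g y \<in> Y" if "g \<in> G" "y \<in> Y" for g y
    using inv that by blast
  have cont: "continuous_on Y g" if "g \<in> G" for g
    using G that \<open>Y \<subseteq> X\<close> by (metis comm_homeo_group_def homeomorphism_def continuous_on_subset)
  have comp: "compose X g h \<in> G" if "g \<in> G" "h \<in> G" for g h
    using m_closed[OF that] mult[OF that] by simp
  show ?thesis
  proof
    show "g (h y) = h (g y)" if "g \<in> G" "h \<in> G" "y \<in> Y" for g h y
    proof -
      have "compose X g h = compose X h g"
        using C.m_comm[of g h] that mult by simp
      then have "compose X g h y = compose X h g y" by simp
      then show ?thesis using that(3) \<open>Y \<subseteq> X\<close> by (auto simp: compose_def)
    qed
    show "\<exists>f\<in>G. \<forall>y\<in>Y. f y = g (h y)" if "g \<in> G" "h \<in> G" for g h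
      using comp[OF that] \<open>Y \<subseteq> X\<close> by (intro bexI[of _ "compose X g h"]) (auto simp: compose_def)
    show "\<exists>h\<in>G. \<forall>y\<in>Y. h (g y) = y" if "g \<in> G" for g
    proof -
      let ?h = "inv\<^bsub>BijGroup X\<^esub> g"
      have "?h \<in> G" using that by (rule m_inv_closed)
      \<comment> \<open>The unit of \<open>BijGroup X\<close> is the identity on \<open>X\<close>,
        so the group inverse is a pointwise inverse on \<open>Y\<close>.\<close>
      moreover have "compose X ?h g = \<one>\<^bsub>BijGroup X\<^esub>"
        using B.l_inv[of g] mem_carrier[OF that] mult[OF \<open>?h \<in> G\<close> that] by simp
      then have "compose X ?h g y = y" if "y \<in> Y" for y
        using that \<open>Y \<subseteq> X\<close> by (auto simp: BijGroup_def)
      then have "\<forall>y\<in>Y. ?h (g y) = y"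
        using \<open>Y \<subseteq> X\<close> by (metis compose_eq subsetD)
      ultimately show ?thesis by blast
    qed
    show "\<exists>g\<in>G. g y \<in> U" if "y \<in> Y" "open U" "U \<inter> Y \<noteq> {}" for y U
    proof -
      let ?A = "(\<lambda>g. g y) ` G"
      have AY: "?A \<subseteq> Y" using maps that(1) by blast
      then have CY: "closure ?A \<subseteq> Y"
        using \<open>compact Y\<close> by (simp add: closure_minimal compact_imp_closed)
      have "?A \<noteq> {}" using one_closed by blast
      have "closure ?A = Y"
      proof (rule min)
        show "g ` closure ?A \<subseteq> closure ?A" if "g \<in> G" for g
        proof (rule image_closure_subset)
          show "continuous_on (closure ?A) g" using cont[OF that] CY by (rule continuous_on_subset)
          have "g (h y) \<in> ?A" if "h \<in> G" for h
            using comp[OF \<open>g \<in> G\<close> that] \<open>y \<in> Y\<close> \<open>Y \<subseteq> X\<close>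
            by (intro image_eqI[of _ _ "compose X g h"]) (auto simp: compose_def)
          then have "g ` ?A \<subseteq> ?A" by blast
          then show "g ` ?A \<subseteq> closure ?A" using closure_subset by (rule subset_trans)
        qed simp
      qed (use CY \<open>?A \<noteq> {}\<close> in auto)
      then have "U \<inter> ?A \<noteq> {}" using that by (metis open_Int_closure_eq_empty)
      then show ?thesis by blast
    qed
  qed (use assms maps cont in auto)
qed

section \<open>Extractions\<close>

text \<open>A common superset of the words and the variable words; on it the \<open>Min\<close> and
  \<open>Max\<close> in both orders are meaningful.\<close>

definition finite_words :: "'a word set" where
  "finite_words = {w. finite (dom w) \<and> dom w \<noteq> {}}"

lemma star_list_Nil [simp]: "star_list [] = Map.empty"
  and star_list_Cons [simp]: "star_list (w # ls) = w ++ star_list ls"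
  by (simp_all add: star_list_def)

lemma dom_star_list: "dom (star_list ls) = (\<Union>w\<in>set ls. dom w)"
  by (induction ls) auto

lemma star_list_closed:
  assumes "ls \<noteq> []" "set ls \<subseteq> V" "\<And>w u. w \<in> V \<Longrightarrow> u \<in> V \<Longrightarrow> w ++ u \<in> V"
  shows "star_list ls \<in> V"
  using assms(1,2) by (induction ls rule: list_nonempty_induct) (auto intro: assms(3))

lemma foldr_eq_on:
  assumes "\<And>n y. n \<in> set ns \<Longrightarrow> y \<in> Y \<Longrightarrow> f n y = g n y \<and> g n y \<in> Y" "y \<in> Y"
  shows "foldr f ns y = foldr g ns y \<and> foldr g ns y \<in> Y"
  using assms(1) by (induction ns) (auto simp: assms(2))

text \<open>The common properties of \<open>less_R1\<close> and \<open>less_R2\<close>, so that one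
  argument serves both parts of the theorem. By \<open>dom_cong\<close>, substitution does not
  affect the order.\<close>

locale block_order =
  fixes R :: "'a word \<Rightarrow> 'a word \<Rightarrow> bool"
  assumes trans: "w \<in> finite_words \<Longrightarrow> u \<in> finite_words \<Longrightarrow> v \<in> finite_words \<Longrightarrow> R w u \<Longrightarrow> R u v \<Longrightarrow> R w v"
    and add_left: "w \<in> finite_words \<Longrightarrow> u \<in> finite_words \<Longrightarrow> v \<in> finite_words \<Longrightarrow> R w u \<Longrightarrow> R w v \<Longrightarrow> R u v \<Longrightarrow> R (w ++ u) v"
    and add_right: "w \<in> finite_words \<Longrightarrow> u \<in> finite_words \<Longrightarrow> v \<in> finite_words \<Longrightarrow> R w u \<Longrightarrow> R w v \<Longrightarrow> R w (u ++ v)"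
    and dom_cong: "dom w = dom w' \<Longrightarrow> dom u = dom u' \<Longrightarrow> R w u \<Longrightarrow> R w' u'"
begin

lemma star_list_finite_words:
  "ls \<noteq> [] \<Longrightarrow> set ls \<subseteq> finite_words \<Longrightarrow> star_list ls \<in> finite_words"
  by (rule star_list_closed) (auto simp: finite_words_def)

lemma star_list_right:
  assumes "ls \<noteq> []" "insert w (set ls) \<subseteq> finite_words" "\<forall>u\<in>set ls. R w u"
  shows "R w (star_list ls)"
  using assms
proof (induction ls rule: list_nonempty_induct)
  case (cons u ls)
  then show ?case
    using add_right[of w u "star_list ls"] star_list_finite_words[of ls] by auto
qed simp

text \<open>Sortedness puts the head before the concatenated tail, as \<open>add_left\<close>
  demands.\<close>

lemma star_list_left:
  assumes "ls \<noteq> []" "insert v (set ls) \<subseteq> finite_words" "sorted_wrt R ls" "\<forall>u\<in>set ls. R u v"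
  shows "R (star_list ls) v"
  using assms
proof (induction ls rule: list_nonempty_induct)
  case (cons u ls)
  then show ?case
    using add_left[of u "star_list ls" v] star_list_finite_words[of ls] star_list_right[of ls u] by auto
qed simp

lemma seq_less:
  assumes "\<And>n. n \<ge> 1 \<Longrightarrow> ws n \<in> finite_words \<and> R (ws n) (ws (Suc n))" "1 \<le> i" "i < j"
  shows "R (ws i) (ws j)"
  using assms(3)
proof (induction j)
  case (Suc j)
  show ?case
  proof (cases "i = j")
    case False
    then have "i < j" using Suc.prems by simp
    then have "R (ws i) (ws j)" "R (ws j) (ws (Suc j))" using Suc.IH assms(1)[of j] assms(2) by auto
    moreover have "ws i \<in> finite_words" "ws j \<in> finite_words" "ws (Suc j) \<in> finite_words"
      using assms(1,2) \<open>i < j\<close> by auto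
    ultimately show ?thesis using trans by blast
  qed (use assms(1,2) in simp)
qed simp

text \<open>The map \<open>f\<close> is constrained only through its domains, so that the lemma
  covers both the words \<open>ws n\<close> and their substitution instances.\<close>

lemma sorted_wrt_map:
  assumes "\<And>n. n \<ge> 1 \<Longrightarrow> ws n \<in> finite_words \<and> R (ws n) (ws (Suc n))"
    and "sorted_wrt (<) ns" "set ns \<subseteq> {1..}" "\<And>n. dom (f n) = dom (ws n)"
  shows "sorted_wrt R (map f ns)"
  using assms(2,3)
proof (induction ns)
  case (Cons n ns)
  have "R (f n) (f j)" if "j \<in> set ns" for j
  proof (rule dom_cong)
    show "R (ws n) (ws j)" using seq_less[of ws n j, OF assms(1)] Cons.prems that by simp
  qed (simp_all add: assms(4))
  then show ?case using Cons by simp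
qed simp

text \<open>In a sorted list the head precedes the concatenation of the tail, so the system law
  peels off one factor at a time.\<close>

lemma system_star_list:
  assumes T: "\<And>w1 w2 y. w1 \<in> W \<Longrightarrow> w2 \<in> W \<Longrightarrow> R w1 w2 \<Longrightarrow> y \<in> Y \<Longrightarrow> T w1 (T w2 y) = T (w1 ++ w2) y"
    and W: "W \<subseteq> finite_words" "\<And>w u. w \<in> W \<Longrightarrow> u \<in> W \<Longrightarrow> w ++ u \<in> W"
    and "ls \<noteq> []" "set ls \<subseteq> W" "sorted_wrt R ls" "y \<in> Y"
  shows "T (star_list ls) y = foldr T ls y"
  using assms(4-6)
proof (induction ls rule: list_nonempty_induct)
  case (cons w ls)
  have ls: "star_list ls \<in> W" using star_list_closed[of ls W] cons W(2) by simp
  have "R w (star_list ls)" using star_list_right[of ls w] cons W(1) by auto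
  then have "T (star_list (w # ls)) y = T w (T (star_list ls) y)"
    using T[of w "star_list ls" y] ls cons.prems \<open>y \<in> Y\<close> by simp
  then show ?case using cons by simp
qed simp

text \<open>\<open>V\<close> stands for the variable words, \<open>W\<close> for the words,
  \<open>sub\<close> for substitution and \<open>P n\<close> for the values admissible at index
  \<open>n\<close>. Each pair of a system and a value gives a family of members of \<open>G\<close>,
  to which \<open>recurrent_point\<close> applies. As block \<open>n\<close> lies in
  \<open>{n..}\<close>, values in \<open>P n\<close> are admissible for all its words.\<close>

lemma recurrent_extraction:
  fixes sub :: "'a word \<Rightarrow> 'p \<Rightarrow> 'a word" and P :: "nat \<Rightarrow> 'p set" and T :: "'i \<Rightarrow> 'a word \<Rightarrow> 'x::metric_space \<Rightarrow> 'x"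
  assumes "minimal_comm_action Y G"
    and V: "V \<subseteq> finite_words" "\<And>w u. w \<in> V \<Longrightarrow> u \<in> V \<Longrightarrow> w ++ u \<in> V"
    and W: "W \<subseteq> finite_words" "\<And>w u. w \<in> W \<Longrightarrow> u \<in> W \<Longrightarrow> w ++ u \<in> W"
    and sub: "\<And>w p. dom (sub w p) = dom w" "\<And>w u p. sub (w ++ u) p = sub w p ++ sub u p"
    and ws: "\<And>n. n \<ge> 1 \<Longrightarrow> ws n \<in> V \<and> R (ws n) (ws (Suc n))"
    and P: "\<And>n. finite (P n)" "\<And>n j p. 1 \<le> n \<Longrightarrow> n \<le> j \<Longrightarrow> p \<in> P n \<Longrightarrow> sub (ws j) p \<in> W"
    and I: "finite I" "\<And>i w. i \<in> I \<Longrightarrow> w \<in> W \<Longrightarrow> T i w \<in> G"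
    and T: "\<And>i w1 w2 y. i \<in> I \<Longrightarrow> w1 \<in> W \<Longrightarrow> w2 \<in> W \<Longrightarrow> R w1 w2 \<Longrightarrow> y \<in> Y \<Longrightarrow> T i w1 (T i w2 y) = T i (w1 ++ w2) y"
    and U: "open U" "U \<inter> Y \<noteq> {}"
  obtains x0 D us where "x0 \<in> U \<inter> Y" "us = (\<lambda>n. star_list (map ws (D n)))"
    "\<And>n. D n \<noteq> []" "\<And>n. sorted_wrt (<) (D n)" "\<And>n. set (D n) \<subseteq> {n..}"
    "\<And>n. n \<ge> 1 \<Longrightarrow> us n \<in> V \<and> R (us n) (us (Suc n))"
    "\<And>e. e > 0 \<Longrightarrow> \<exists>N. \<forall>i\<in>I. \<forall>ns p. ns \<noteq> [] \<and> sorted_wrt (<) ns \<and> set ns \<subseteq> {1..} \<inter> {N..} \<and> (\<forall>n\<in>set ns. p n \<in> P n) \<longrightarrow>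
       dist (T i (star_list (map (\<lambda>n. sub (us n) (p n)) ns)) x0) x0 < e"
proof -
  interpret minimal_comm_action Y G by fact
  \<comment> \<open>Word sequences start at index 1; the empty \<open>S 0\<close> makes the
    hypotheses at index 0 vacuous.\<close>
  define S where "S n = (if n = 0 then {} else I \<times> P n)" for n
  define t where "t s j = T (fst s) (sub (ws j) (snd s))" for s j
  have S: "finite (S n)" for n using I(1) P(1) by (simp add: S_def)
  have tG: "t s j \<in> G" if "s \<in> S n" "n \<le> j" for n s j
    using that I(2) P(2)[of n j] by (auto simp: S_def t_def split: if_splits)
  obtain x0 D where x0: "x0 \<in> U \<inter> Y"
    and D: "\<And>n. D n \<noteq> []" "\<And>n. sorted_wrt (<) (D n)" "\<And>n. set (D n) \<subseteq> {n..}"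
      "\<And>n i j. i \<in> set (D n) \<Longrightarrow> j \<in> set (D (Suc n)) \<Longrightarrow> i < j"
    and rec: "\<And>e. e > 0 \<Longrightarrow> \<exists>N. \<forall>ns s. sorted_wrt (<) ns \<and> set ns \<subseteq> {N..} \<and> (\<forall>n\<in>set ns. s n \<in> S n) \<longrightarrow>
       dist (foldr (\<lambda>n. foldr (t (s n)) (D n)) ns x0) x0 < e"
  proof (rule recurrent_point[of S t, OF S _ U])
    show "t s j \<in> G" if "s \<in> S n" "n \<le> j" for n s j using that by (rule tG)
  qed (rule that)
  define us where "us n = star_list (map ws (D n))" for n
  have ws': "ws n \<in> finite_words \<and> R (ws n) (ws (Suc n))" if "n \<ge> 1" for n
    using ws V(1) that by blast
  have D1: "set (D n) \<subseteq> {1..}" if "n \<ge> 1" for n using D(3)[of n] that by auto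
  have usV: "us n \<in> V" if "n \<ge> 1" for n
    unfolding us_def using D(1) D1[OF that] ws V(2) by (intro star_list_closed) auto
  have usR: "R (us n) (us (Suc n))" if "n \<ge> 1" for n
  proof -
    have fin: "set (map ws (D n)) \<subseteq> finite_words" "set (map ws (D (Suc n))) \<subseteq> finite_words"
      using D1[OF that] D1[of "Suc n"] ws' by auto
    have "R (ws i) (us (Suc n))" if "i \<in> set (D n)" for i
      unfolding us_def
    proof (rule star_list_right)
      show "\<forall>u\<in>set (map ws (D (Suc n))). R (ws i) u"
        using seq_less[of ws i, OF ws'] D1[OF \<open>n \<ge> 1\<close>] D(4) that by auto
    qed (use D(1) fin that in auto)
    moreover have "us (Suc n) \<in> finite_words" using usV[of "Suc n"] V(1) by auto
    ultimately show ?thesis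
      unfolding us_def[of n] using D(1) fin(1) sorted_wrt_map[of ws, OF ws' D(2) D1[OF that] refl]
      by (intro star_list_left) auto
  qed
  have us': "us n \<in> finite_words \<and> R (us n) (us (Suc n))" if "n \<ge> 1" for n
    using usV usR V(1) that by blast
  \<comment> \<open>No variable has been replaced inside \<open>us n\<close>, so substituting a
    value into \<open>us n\<close> substitutes the same value into every \<open>ws j\<close> of its
    block.\<close>
  have sub_star: "sub (star_list ls) p = star_list (map (\<lambda>w. sub w p) ls)" if "ls \<noteq> []" for ls p
    using that by (induction ls rule: list_nonempty_induct) (simp_all add: sub(2))
  have sub_us: "sub (us n) p = star_list (map (\<lambda>j. sub (ws j) p) (D n))" for n p
    using D(1) by (simp add: us_def sub_star comp_def)
  have sub_us_W: "sub (us n) p \<in> W" if "n \<ge> 1" "p \<in> P n" for n p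
    unfolding sub_us using D(1,3) P(2)[OF that(1) _ that(2)] W(2) by (intro star_list_closed) auto
  \<comment> \<open>With \<open>p\<close> fixed along the block, the map of the whole word is the
    product of the single family \<open>t (i, p)\<close>.\<close>
  have T_us: "T i (sub (us n) p) y = foldr (t (i, p)) (D n) y" if "i \<in> I" "n \<ge> 1" "p \<in> P n" "y \<in> Y" for i n p y
  proof -
    have "T i (sub (us n) p) y = foldr (T i) (map (\<lambda>j. sub (ws j) p) (D n)) y"
      unfolding sub_us
    proof (rule system_star_list[of W Y])
      show "set (map (\<lambda>j. sub (ws j) p) (D n)) \<subseteq> W" using D(3) P(2)[OF that(2) _ that(3)] by auto
      show "sorted_wrt R (map (\<lambda>j. sub (ws j) p) (D n))"
        by (rule sorted_wrt_map[of ws, OF ws' D(2) D1[OF that(2)]]) (use sub(1) in auto)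
    qed (use T W D(1) that in auto)
    then show ?thesis by (simp add: foldr_map comp_def t_def[abs_def])
  qed
  show thesis
  proof (rule that)
    show "us = (\<lambda>n. star_list (map ws (D n)))" by (rule ext) (rule us_def)
    show "us n \<in> V \<and> R (us n) (us (Suc n))" if "n \<ge> 1" for n using usV usR that by blast
    fix e :: real assume "e > 0"
    then obtain N where N: "\<And>ns s. sorted_wrt (<) ns \<Longrightarrow> set ns \<subseteq> {N..} \<Longrightarrow> \<forall>n\<in>set ns. s n \<in> S n \<Longrightarrow>
       dist (foldr (\<lambda>n. foldr (t (s n)) (D n)) ns x0) x0 < e"
      using rec by metis
    have "dist (T i (star_list (map (\<lambda>n. sub (us n) (p n)) ns)) x0) x0 < e"
      if "i \<in> I" "ns \<noteq> []" "sorted_wrt (<) ns" "set ns \<subseteq> {1..} \<inter> {N..}" "\<forall>n\<in>set ns. p n \<in> P n" for i ns p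
    proof -
      have ns1: "set ns \<subseteq> {1..}" using that(4) by blast
      have W': "sub (us n) (p n) \<in> W" if "n \<in> set ns" for n
        using sub_us_W ns1 that \<open>\<forall>n\<in>set ns. p n \<in> P n\<close> by auto
      have "T i (star_list (map (\<lambda>n. sub (us n) (p n)) ns)) x0 = foldr (T i) (map (\<lambda>n. sub (us n) (p n)) ns) x0"
      proof (rule system_star_list[of W Y])
        show "sorted_wrt R (map (\<lambda>n. sub (us n) (p n)) ns)"
          by (rule sorted_wrt_map[of us, OF us' that(3) ns1]) (use sub(1) in auto)
      qed (use T W W' that(1,2) x0 in auto)
      also have "\<dots> = foldr (\<lambda>n. T i (sub (us n) (p n))) ns x0"
        by (simp add: foldr_map comp_def)
      also have "\<dots> = foldr (\<lambda>n. foldr (t (i, p n)) (D n)) ns x0"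
      proof (rule conjunct1[OF foldr_eq_on])
        fix n y assume n: "n \<in> set ns" "y \<in> Y"
        then have "T i (sub (us n) (p n)) y = foldr (t (i, p n)) (D n) y"
          using T_us that(1,5) ns1 by auto
        moreover have "T i (sub (us n) (p n)) y \<in> Y"
          using maps I(2) W' that(1) n by blast
        ultimately show "T i (sub (us n) (p n)) y = foldr (t (i, p n)) (D n) y \<and> foldr (t (i, p n)) (D n) y \<in> Y"
          by simp
      qed (use x0 in blast)
      also have "dist \<dots> x0 < e"
      proof (rule N)
        show "\<forall>n\<in>set ns. (i, p n) \<in> S n" using that(1,5) ns1 by (fastforce simp: S_def)
      qed (use that in auto)
      finally show ?thesis .
    qed
    then show "\<exists>N. \<forall>i\<in>I. \<forall>ns p. ns \<noteq> [] \<and> sorted_wrt (<) ns \<and> set ns \<subseteq> {1..} \<inter> {N..} \<and> (\<forall>n\<in>set ns. p n \<in> P n) \<longrightarrow>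
       dist (T i (star_list (map (\<lambda>n. sub (us n) (p n)) ns)) x0) x0 < e"
      by blast
  qed (fact x0 D)+
qed

end

section \<open>The two concrete orders\<close>

text \<open>The two parts of \<open>dom u\<close> must be the positions below and above
  \<open>dom w\<close>. Eliminating \<open>Min\<close> and \<open>Max\<close> reduces the locale
  axioms to reasoning with quantifiers.\<close>

lemma less_R1_iff:
  assumes "w \<in> finite_words" "u \<in> finite_words"
  shows "less_R1 w u \<longleftrightarrow> (\<exists>a\<in>dom u. \<forall>b\<in>dom w. a < b) \<and> (\<exists>a\<in>dom u. \<forall>b\<in>dom w. b < a) \<and>
    (\<forall>a\<in>dom u. (\<forall>b\<in>dom w. a < b) \<or> (\<forall>b\<in>dom w. b < a))"
    (is "_ = ?rhs")
proof
  have w: "finite (dom w)" "dom w \<noteq> {}" and u: "finite (dom u)"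
    using assms by (auto simp: finite_words_def)
  show ?rhs if "less_R1 w u"
  proof -
    obtain A B where AB: "dom u = A \<union> B" "A \<noteq> {}" "B \<noteq> {}" "Max A < Min (dom w)" "Max (dom w) < Min B"
      using \<open>less_R1 w u\<close> by (auto simp: less_R1_def)
    have "finite A" "finite B" using u AB(1) by auto
    have "\<forall>a\<in>A. \<forall>b\<in>dom w. a < b"
      using AB(4) Max_ge[OF \<open>finite A\<close>] Min_le[OF w(1)] by (meson le_less_trans less_le_trans)
    moreover have "\<forall>a\<in>B. \<forall>b\<in>dom w. b < a"
      using AB(5) Min_le[OF \<open>finite B\<close>] Max_ge[OF w(1)] by (meson le_less_trans less_le_trans)
    ultimately show ?rhs
      unfolding AB(1) using AB(2,3) by (meson UnE UnI1 UnI2 ex_in_conv)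
  qed
  show "less_R1 w u" if ?rhs
  proof -
    let ?A = "{a \<in> dom u. \<forall>b\<in>dom w. a < b}" and ?B = "{a \<in> dom u. \<forall>b\<in>dom w. b < a}"
    have "dom u = ?A \<union> ?B" "?A \<noteq> {}" "?B \<noteq> {}" "finite ?A" "finite ?B"
      using \<open>?rhs\<close> u by auto
    moreover from this have "Max ?A < Min (dom w)" "Max (dom w) < Min ?B"
      using w by simp_all
    moreover have "Min (dom w) \<le> Max (dom w)" using w by simp
    ultimately show ?thesis unfolding less_R1_def by blast
  qed
qed

lemma less_R2_iff:
  assumes "w \<in> finite_words" "u \<in> finite_words"
  shows "less_R2 w u \<longleftrightarrow> (\<forall>a\<in>dom u. \<forall>b\<in>dom w. b < a)"
  using assms by (auto simp: less_R2_def finite_words_def)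

lemma finite_words_add: "w \<in> finite_words \<Longrightarrow> u \<in> finite_words \<Longrightarrow> w ++ u \<in> finite_words"
  by (auto simp: finite_words_def)

lemma finite_words_nonempty: "w \<in> finite_words \<Longrightarrow> \<exists>a. a \<in> dom w"
  by (auto simp: finite_words_def)

interpretation R1: block_order less_R1
proof
  fix w u v :: "'a word"
  assume fin: "w \<in> finite_words" "u \<in> finite_words" "v \<in> finite_words"
  show "less_R1 w v" if "less_R1 w u" "less_R1 u v"
  proof -
    \<comment> \<open>Since \<open>u\<close> has positions on both sides of \<open>w\<close>,
      whatever lies beyond \<open>u\<close> on one side lies beyond \<open>w\<close> on that
      side.\<close>
    obtain c d where c: "c \<in> dom u" "\<forall>b\<in>dom w. c < b" and d: "d \<in> dom u" "\<forall>b\<in>dom w. b < d"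
      using \<open>less_R1 w u\<close> unfolding less_R1_iff[OF fin(1,2)] by blast
    have "\<forall>b\<in>dom w. a < b" if "\<forall>b\<in>dom u. a < b" for a
      using c that by (meson order.strict_trans)
    moreover have "\<forall>b\<in>dom w. b < a" if "\<forall>b\<in>dom u. b < a" for a
      using d that by (meson order.strict_trans)
    ultimately show ?thesis
      using that(2) unfolding less_R1_iff[OF fin(2,3)] less_R1_iff[OF fin(1,3)] by meson
  qed
  show "less_R1 w (u ++ v)" if "less_R1 w u" "less_R1 w v"
    using that unfolding less_R1_iff[OF fin(1,2)] less_R1_iff[OF fin(1,3)]
      less_R1_iff[OF fin(1) finite_words_add[OF fin(2,3)]] dom_map_add 
    by (simp only: ball_Un bex_Un simp_thms) (elim conjE, intro conjI; assumption)
  show "less_R1 (w ++ u) v" if "less_R1 w u" "less_R1 w v" "less_R1 u v"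
  proof -
    have "\<forall>b\<in>dom w \<union> dom u. a < b" if a: "\<forall>b\<in>dom u. a < b" for a
    proof -
      obtain c where "c \<in> dom u" "\<forall>b\<in>dom w. c < b"
        using \<open>less_R1 w u\<close> unfolding less_R1_iff[OF fin(1,2)] by blast
      then show ?thesis using a by (metis Un_iff order.strict_trans)
    qed
    moreover have "\<forall>b\<in>dom w \<union> dom u. b < a" if a: "\<forall>b\<in>dom u. b < a" for a
    proof -
      obtain d where "d \<in> dom u" "\<forall>b\<in>dom w. b < d"
        using \<open>less_R1 w u\<close> unfolding less_R1_iff[OF fin(1,2)] by blast
      then show ?thesis using a by (metis Un_iff order.strict_trans)
    qed
    ultimately show ?thesis
      using that(3) unfolding less_R1_iff[OF fin(2,3)] less_R1_iff[OF finite_words_add[OF fin(1,2)] fin(3)]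
        dom_map_add Un_commute[of "dom u"] by meson
  qed
qed (simp add: less_R1_def)

interpretation R2: block_order less_R2
proof
  fix w u v :: "'a word"
  assume fin: "w \<in> finite_words" "u \<in> finite_words" "v \<in> finite_words"
  show "less_R2 w v" if "less_R2 w u" "less_R2 u v"
    using that finite_words_nonempty[OF fin(2)]
    unfolding less_R2_iff[OF fin(1,2)] less_R2_iff[OF fin(2,3)] less_R2_iff[OF fin(1,3)]
    by (meson order.strict_trans)
  show "less_R2 w (u ++ v)" if "less_R2 w u" "less_R2 w v"
    using that unfolding less_R2_iff[OF fin(1,2)] less_R2_iff[OF fin(1,3)]
      less_R2_iff[OF fin(1) finite_words_add[OF fin(2,3)]] dom_map_add by blast
  show "less_R2 (w ++ u) v" if "less_R2 w u" "less_R2 w v" "less_R2 u v"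
    using that unfolding less_R2_iff[OF fin(2,3)] less_R2_iff[OF fin(1,3)]
      less_R2_iff[OF finite_words_add[OF fin(1,2)] fin(3)] dom_map_add by blast
qed (simp add: less_R2_def)

section \<open>Closure properties of the classes of words and admissible substitutions\<close>

lemma map_add_ball_dom:
  assumes "\<forall>n\<in>dom w. Q n (the (w n))" "\<forall>n\<in>dom u. Q n (the (u n))"
  shows "\<forall>n\<in>dom (w ++ u). Q n (the ((w ++ u) n))"
proof
  fix n assume "n \<in> dom (w ++ u)"
  then show "Q n (the ((w ++ u) n))"
    using assms by (cases "n \<in> dom u") (auto simp: map_add_dom_app_simps)
qed

text \<open>Where the domains overlap the value of \<open>u\<close> prevails, so the variable
  attained by \<open>u\<close> survives.\<close>

lemma var_words_add: "w \<in> var_words \<alpha> k \<upsilon> \<Longrightarrow> u \<in> var_words \<alpha> k \<upsilon> \<Longrightarrow> w ++ u \<in> var_words \<alpha> k \<upsilon>"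
  using map_add_ball_dom[of w "\<lambda>n a. a \<in> insert \<upsilon> (letters \<alpha> k n)" u]
  unfolding var_words_def by (auto simp: ran_def intro: map_add_find_right)

lemma var_words2_add: "w \<in> var_words2 \<alpha> k \<upsilon> \<Longrightarrow> u \<in> var_words2 \<alpha> k \<upsilon> \<Longrightarrow> w ++ u \<in> var_words2 \<alpha> k \<upsilon>"
  unfolding var_words2_def by (auto intro: var_words_add map_add_find_right)

lemma var_words1_add: "w \<in> var_words1 \<alpha> k \<upsilon> \<Longrightarrow> u \<in> var_words1 \<alpha> k \<upsilon> \<Longrightarrow> w ++ u \<in> var_words1 \<alpha> k \<upsilon>"
  using var_words_add by (auto simp: var_words1_def)

lemma words2_add: "w \<in> words2 \<alpha> k \<Longrightarrow> u \<in> words2 \<alpha> k \<Longrightarrow> w ++ u \<in> words2 \<alpha> k"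
  using map_add_ball_dom[of w "\<lambda>n a. a \<in> letters \<alpha> k n" u] unfolding words2_def by auto

lemma words1_add: "w \<in> words1 \<alpha> k \<Longrightarrow> u \<in> words1 \<alpha> k \<Longrightarrow> w ++ u \<in> words1 \<alpha> k"
  using words2_add by (auto simp: words1_def)

lemma finite_words_supersets:
  "words2 \<alpha> k \<subseteq> finite_words" "words1 \<alpha> k \<subseteq> finite_words"
  "var_words2 \<alpha> k \<upsilon> \<subseteq> finite_words" "var_words1 \<alpha> k \<upsilon> \<subseteq> finite_words"
  by (auto simp: words2_def words1_def var_words_def var_words2_def var_words1_def finite_words_def)

lemma dom_subst2 [simp]: "dom (subst2 \<alpha> \<upsilon> w p q) = dom w"
  by (auto simp: subst2_def split: if_splits)

lemma dom_subst1 [simp]: "dom (subst1 \<alpha> \<upsilon> w p) = dom w"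
  by (auto simp: subst1_def split: if_splits)

lemma subst2_add: "subst2 \<alpha> \<upsilon> (w ++ u) p q = subst2 \<alpha> \<upsilon> w p q ++ subst2 \<alpha> \<upsilon> u p q"
  by (rule ext) (auto simp: subst2_def map_add_def split: option.splits)

lemma subst1_add: "subst1 \<alpha> \<upsilon> (w ++ u) p = subst1 \<alpha> \<upsilon> w p ++ subst1 \<alpha> \<upsilon> u p"
  by (rule ext) (auto simp: subst1_def map_add_def split: option.splits)

text \<open>\<open>ws n\<close> has a negative and a positive position, and every position of
  \<open>ws (Suc n)\<close> lies outside the range of \<open>ws n\<close>; hence absolute values
  grow by at least one per step.\<close>

lemma var_seqs2_dom:
  assumes "ws \<in> var_seqs2 \<alpha> k \<upsilon>" "n \<ge> 1" "a \<in> dom (ws n)"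
  shows "int n \<le> \<bar>a\<bar>"
  using assms(2,3)
proof (induction n arbitrary: a rule: nat_induct_at_least)
  case base
  have "ws 1 \<in> var_words \<alpha> k \<upsilon>" using assms(1) by (simp add: var_seqs2_def var_words2_def)
  then have "0 \<notin> dom (ws 1)" by (simp add: var_words_def)
  then have "a \<noteq> 0" using base by metis
  then show ?case by simp
next
  case (Suc n)
  have w: "ws n \<in> var_words2 \<alpha> k \<upsilon>" "ws (Suc n) \<in> var_words2 \<alpha> k \<upsilon>" "less_R1 (ws n) (ws (Suc n))"
    using assms(1) Suc.hyps by (auto simp: var_seqs2_def)
  then have fin: "ws n \<in> finite_words" "ws (Suc n) \<in> finite_words"
    using subsetD[OF finite_words_supersets(3)] by metis+
  have "(\<forall>b\<in>dom (ws n). a < b) \<or> (\<forall>b\<in>dom (ws n). b < a)"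
    using w(3) Suc.prems unfolding less_R1_iff[OF fin] by blast
  moreover obtain b c where "b \<in> dom (ws n)" "c \<in> dom (ws n)" "b < 0" "c > 0"
    using w(1) by (auto simp: var_words2_def)
  moreover from this have "int n \<le> \<bar>b\<bar>" "int n \<le> \<bar>c\<bar>" by (simp_all only: Suc.IH)
  ultimately have "a < b \<or> c < a" "b < 0" "c > 0" "int n \<le> \<bar>b\<bar>" "int n \<le> \<bar>c\<bar>"
    by blast+
  then show ?case by linarith
qed

lemma var_seqs1_dom:
  assumes "ws \<in> var_seqs1 \<alpha> k \<upsilon>" "n \<ge> 1" "a \<in> dom (ws n)"
  shows "int n \<le> a"
  using assms(2,3)
proof (induction n arbitrary: a rule: nat_induct_at_least)
  case base
  have "ws 1 \<in> var_words1 \<alpha> k \<upsilon>" using assms(1) by (simp add: var_seqs1_def)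
  then show ?case using base by (auto simp: var_words1_def)
next
  case (Suc n)
  have w: "ws n \<in> finite_words" "ws (Suc n) \<in> finite_words" "less_R2 (ws n) (ws (Suc n))"
    using assms(1) Suc.hyps finite_words_supersets(4) by (fastforce simp: var_seqs1_def)+
  obtain b where b: "b \<in> dom (ws n)" using finite_words_nonempty[OF w(1)] by blast
  have "b < a" using w(3) b Suc.prems unfolding less_R2_iff[OF w(1,2)] by blast
  then show ?case using Suc.IH[OF b] by simp
qed

text \<open>A position \<open>a\<close> of \<open>ws j\<close> satisfies
  \<open>n \<le> j \<le> \<bar>a\<bar>\<close>, so monotonicity of \<open>k\<close> on each side
  turns the bounds at \<open>n\<close> and \<open>- n\<close> into the bound at
  \<open>a\<close>.\<close>

lemma subst2_words2:
  assumes "mono_on {1..} k" "mono_on {1..} (\<lambda>n. k (- n))" "ws \<in> var_seqs2 \<alpha> k \<upsilon>"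
    and "1 \<le> n" "n \<le> j" "p \<in> {1..k (int n)}" "q \<in> {1..k (- int n)}"
  shows "subst2 \<alpha> \<upsilon> (ws j) p q \<in> words2 \<alpha> k"
proof -
  have ws: "ws j \<in> var_words \<alpha> k \<upsilon>" using assms(3-5) by (simp add: var_seqs2_def var_words2_def)
  have "the (subst2 \<alpha> \<upsilon> (ws j) p q a) \<in> letters \<alpha> k a" if a: "a \<in> dom (ws j)" for a
  proof (cases "ws j a = Some \<upsilon>")
    case True
    have "int n \<le> \<bar>a\<bar>" using var_seqs2_dom[OF assms(3) _ a] assms(4,5) by simp
    then have "p \<le> k a" if "a > 0"
      using mono_onD[OF assms(1), of "int n" a] that assms(4,6) by auto
    \<comment> \<open>The value \<open>a = 0\<close> is excluded by
      \<open>1 \<le> n \<le> \<bar>a\<bar>\<close>.\<close>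
    moreover have "q \<le> k a" if "a \<le> 0"
      using mono_onD[OF assms(2), of "int n" "- a"] that assms(4,7) \<open>int n \<le> \<bar>a\<bar>\<close> by auto
    ultimately show ?thesis
      using True assms(6,7) by (auto simp: subst2_def letters_def)
  next
    case False
    moreover have "the (ws j a) \<in> insert \<upsilon> (letters \<alpha> k a)"
      using ws a unfolding var_words_def by blast
    ultimately show ?thesis using a by (auto simp: subst2_def)
  qed
  then show ?thesis using ws by (simp add: words2_def var_words_def del: dom_eq_empty_conv)
qed

lemma subst1_words1:
  assumes "mono_on {1..} k" "ws \<in> var_seqs1 \<alpha> k \<upsilon>" "1 \<le> n" "n \<le> j" "p \<in> {1..k (int n)}"
  shows "subst1 \<alpha> \<upsilon> (ws j) p \<in> words1 \<alpha> k"
proof -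
  have ws: "ws j \<in> var_words \<alpha> k \<upsilon>" "dom (ws j) \<subseteq> {1..}"
    using assms(2-4) by (simp_all add: var_seqs1_def var_words1_def)
  have "the (subst1 \<alpha> \<upsilon> (ws j) p a) \<in> letters \<alpha> k a" if a: "a \<in> dom (ws j)" for a
  proof (cases "ws j a = Some \<upsilon>")
    case True
    have "int n \<le> a" using var_seqs1_dom[OF assms(2) _ a] assms(3,4) by simp
    then have "p \<le> k a"
      using mono_onD[OF assms(1), of "int n" a] assms(3,5) by auto
    then show ?thesis
      using True assms(3,5) \<open>int n \<le> a\<close> by (auto simp: subst1_def letters_def)
  next
    case False
    moreover have "the (ws j a) \<in> insert \<upsilon> (letters \<alpha> k a)"
      using ws a unfolding var_words_def by blast
    ultimately show ?thesis using a by (auto simp: subst1_def)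
  qed
  then show ?thesis using ws by (simp add: words1_def words2_def var_words_def del: dom_eq_empty_conv)
qed

section \<open>Recurrence along extractions of two-sided and one-sided words\<close>

text \<open>After \<open>R1.recurrent_extraction\<close> it remains to pass from an estimate for
  large indices \<open>n\<close> of the \<open>us n\<close> to one for words whose positions are far
  from zero.\<close>

lemma recurrent_extraction2:
  fixes Y :: "'x::metric_space set"
  assumes mono: "mono_on {1..} k" "mono_on {1..} (\<lambda>n. k (- n))" and "minimal_comm_action Y G" "Y \<subseteq> X"
    and T: "\<And>i. i \<in> I \<Longrightarrow> system2 \<alpha> k X (T i) \<and> (\<forall>w\<in>words2 \<alpha> k. T i w \<in> G)" "finite I"
    and ws: "ws \<in> var_seqs2 \<alpha> k \<upsilon>" and U: "open U" "U \<inter> Y \<noteq> {}"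
  obtains x0 us where "x0 \<in> U \<inter> Y" "extraction2 \<alpha> k \<upsilon> us ws"
    "\<forall>i\<in>I. R1_lim (extr2 \<alpha> k \<upsilon> us) (\<lambda>w. T i w x0) x0"
proof -
  define sub where "sub w pq = subst2 \<alpha> \<upsilon> w (fst pq) (snd pq)" for w pq
  define P where "P n = {1..k (int n)} \<times> {1..k (- int n)}" for n
  obtain x0 D us where x0: "x0 \<in> U \<inter> Y" and us: "us = (\<lambda>n. star_list (map ws (D n)))"
    and D: "\<And>n. D n \<noteq> []" "\<And>n. sorted_wrt (<) (D n)" "\<And>n. set (D n) \<subseteq> {n..}"
    and usV: "\<And>n. n \<ge> 1 \<Longrightarrow> us n \<in> var_words2 \<alpha> k \<upsilon> \<and> less_R1 (us n) (us (Suc n))"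
    and lim: "\<And>e. e > 0 \<Longrightarrow> \<exists>N. \<forall>i\<in>I. \<forall>ns p. ns \<noteq> [] \<and> sorted_wrt (<) ns \<and> set ns \<subseteq> {1..} \<inter> {N..} \<and> (\<forall>n\<in>set ns. p n \<in> P n) \<longrightarrow>
       dist (T i (star_list (map (\<lambda>n. sub (us n) (p n)) ns)) x0) x0 < e"
  proof (rule R1.recurrent_extraction[of Y G "var_words2 \<alpha> k \<upsilon>" "words2 \<alpha> k" sub ws P I T U])
    show "sub (ws j) p \<in> words2 \<alpha> k" if "1 \<le> n" "n \<le> j" "p \<in> P n" for n j p
      using subst2_words2[OF mono ws that(1,2)] that(3) by (auto simp: sub_def P_def)
    show "T i w1 (T i w2 y) = T i (w1 ++ w2) y"
      if "i \<in> I" "w1 \<in> words2 \<alpha> k" "w2 \<in> words2 \<alpha> k" "less_R1 w1 w2" "y \<in> Y" for i w1 w2 y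
      using T(1)[OF that(1)] that \<open>Y \<subseteq> X\<close> unfolding system2_def by blast
    show "ws n \<in> var_words2 \<alpha> k \<upsilon> \<and> less_R1 (ws n) (ws (Suc n))" if "n \<ge> 1" for n
      using ws that by (simp add: var_seqs2_def)
    show "T i w \<in> G" if "i \<in> I" "w \<in> words2 \<alpha> k" for i w using T(1) that by blast
    show "dom (sub w p) = dom w" "sub (w ++ u) p = sub w p ++ sub u p" for w u p
      by (simp_all add: sub_def subst2_add)
    show "finite (P n)" for n by (simp add: P_def)
    show "w ++ u \<in> var_words2 \<alpha> k \<upsilon>" if "w \<in> var_words2 \<alpha> k \<upsilon>" "u \<in> var_words2 \<alpha> k \<upsilon>" for w u
      using that by (rule var_words2_add)
    show "w ++ u \<in> words2 \<alpha> k" if "w \<in> words2 \<alpha> k" "u \<in> words2 \<alpha> k" for w u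
      using that by (rule words2_add)
    show "var_words2 \<alpha> k \<upsilon> \<subseteq> finite_words" "words2 \<alpha> k \<subseteq> finite_words"
      by (rule finite_words_supersets)+
    show "minimal_comm_action Y G" "finite I" "open U" "U \<inter> Y \<noteq> {}" by fact+
  qed (rule that)
  have usV2: "us n \<in> var_words2 \<alpha> k \<upsilon>" if "n \<ge> 1" for n using usV that by blast
  have "us n \<in> var_extr2 \<alpha> k \<upsilon> ws" if "n \<ge> 1" for n
    unfolding var_extr2_def mem_Collect_eq
  proof (intro exI conjI)
    \<comment> \<open>\<open>Map.empty\<close> is the choice that leaves the variable in place in
      every \<open>ws j\<close>.\<close>
    show "us n = star_list (map (\<lambda>j. inst2 \<alpha> \<upsilon> (ws j) (Map.empty j)) (D n))"
      by (simp add: us inst2_def)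
    show "\<exists>j\<in>set (D n). Map.empty j = None" using D(1)[of n] by (cases "D n") auto
  qed (use D(1-3)[of n] that in auto)
  then have "extraction2 \<alpha> k \<upsilon> us ws"
    using usV by (simp add: extraction2_def var_seqs2_def)
  moreover have "R1_lim (extr2 \<alpha> k \<upsilon> us) (\<lambda>w. T i w x0) x0" if "i \<in> I" for i
    unfolding R1_lim_def
  proof (intro allI impI)
    fix V assume "open V \<and> x0 \<in> V"
    then obtain e where e: "e > 0" "\<And>x. dist x x0 < e \<Longrightarrow> x \<in> V" by (metis open_dist)
    obtain N where N: "\<And>ns p. ns \<noteq> [] \<Longrightarrow> sorted_wrt (<) ns \<Longrightarrow> set ns \<subseteq> {1..} \<inter> {N..} \<Longrightarrow> \<forall>n\<in>set ns. p n \<in> P n \<Longrightarrow>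
       dist (T i (star_list (map (\<lambda>n. sub (us n) (p n)) ns)) x0) x0 < e"
      using lim[OF e(1)] \<open>i \<in> I\<close> by metis
    have "\<exists>a. a \<in> dom_pos (us j)" if "j \<ge> 1" for j
      using usV2[OF that] unfolding var_words2_def dom_pos_def by blast
    then obtain a where a: "\<And>j. j \<ge> 1 \<Longrightarrow> a j \<in> dom_pos (us j)" by metis
    \<comment> \<open>A word built from some \<open>us j\<close> with \<open>j < N\<close> has the
      positive position \<open>a j\<close>, so its least positive position is below
      \<open>n0\<close>. \<open>Suc\<close> makes the bound strict and \<open>n0\<close>
      positive.\<close>
    define n0 where "n0 = Suc (nat (Max (a ` {..N})))"
    have n0: "a j < int n0" if "j < N" for j
    proof -
      have "a j \<le> Max (a ` {..N})" using that by (intro Max_ge) auto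
      then show ?thesis by (simp add: n0_def)
    qed
    have "T i w x0 \<in> V" if w: "w \<in> extr2 \<alpha> k \<upsilon> us" and min: "int n0 \<le> min (- Max (dom_neg w)) (Min (dom_pos w))" for w
    proof -
      obtain ns p q where w: "w = star_list (map (\<lambda>j. subst2 \<alpha> \<upsilon> (us j) (p j) (q j)) ns)"
        and ns: "ns \<noteq> []" "sorted_wrt (<) ns" "\<forall>j\<in>set ns. j \<ge> 1 \<and> p j \<in> {1..k (int j)} \<and> q j \<in> {1..k (- int j)}"
        using w by (auto simp: extr2_def)
      have dom: "dom w = (\<Union>j\<in>set ns. dom (us j))" by (simp add: w dom_star_list)
      have "finite (dom w)"
        unfolding dom using ns(3) usV2 by (auto simp: var_words2_def var_words_def)
      then have fin: "finite (dom_pos w)" by (simp add: dom_pos_def)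
      have "j \<ge> N" if "j \<in> set ns" for j
      proof (rule ccontr)
        assume "\<not> j \<ge> N"
        moreover have "a j \<in> dom_pos w" using a[of j] ns(3) that dom by (auto simp: dom_pos_def)
        then have "Min (dom_pos w) \<le> a j" using fin by simp
        ultimately show False using n0[of j] min by simp
      qed
      then have "dist (T i (star_list (map (\<lambda>n. sub (us n) (p n, q n)) ns)) x0) x0 < e"
        using ns by (intro N) (auto simp: P_def)
      then show ?thesis using e(2) by (simp add: w sub_def)
    qed
    moreover have "n0 \<ge> 1" by (simp add: n0_def)
    ultimately show "\<exists>n0\<ge>1. \<forall>w\<in>extr2 \<alpha> k \<upsilon> us. int n0 \<le> min (- Max (dom_neg w)) (Min (dom_pos w)) \<longrightarrow> T i w x0 \<in> V"
      by blast
  qed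
  ultimately show thesis using that x0 by blast
qed

text \<open>The one-sided analogue, with single values in place of pairs and \<open>less_R2\<close>
  as the order.\<close>

lemma recurrent_extraction1:
  fixes Y :: "'x::metric_space set"
  assumes mono: "mono_on {1..} k" and "minimal_comm_action Y G" "Y \<subseteq> X"
    and T: "\<And>i. i \<in> I \<Longrightarrow> system1 \<alpha> k X (T i) \<and> (\<forall>w\<in>words1 \<alpha> k. T i w \<in> G)" "finite I"
    and ws: "ws \<in> var_seqs1 \<alpha> k \<upsilon>" and U: "open U" "U \<inter> Y \<noteq> {}"
  obtains x0 us where "x0 \<in> U \<inter> Y" "extraction1 \<alpha> k \<upsilon> us ws"
    "\<forall>i\<in>I. R2_lim (extr1 \<alpha> k \<upsilon> us) (\<lambda>w. T i w x0) x0"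
proof -
  define P where "P n = {1..k (int n)}" for n
  obtain x0 D us where x0: "x0 \<in> U \<inter> Y" and us: "us = (\<lambda>n. star_list (map ws (D n)))"
    and D: "\<And>n. D n \<noteq> []" "\<And>n. sorted_wrt (<) (D n)" "\<And>n. set (D n) \<subseteq> {n..}"
    and usV: "\<And>n. n \<ge> 1 \<Longrightarrow> us n \<in> var_words1 \<alpha> k \<upsilon> \<and> less_R2 (us n) (us (Suc n))"
    and lim: "\<And>e. e > 0 \<Longrightarrow> \<exists>N. \<forall>i\<in>I. \<forall>ns p. ns \<noteq> [] \<and> sorted_wrt (<) ns \<and> set ns \<subseteq> {1..} \<inter> {N..} \<and> (\<forall>n\<in>set ns. p n \<in> P n) \<longrightarrow>
       dist (T i (star_list (map (\<lambda>n. subst1 \<alpha> \<upsilon> (us n) (p n)) ns)) x0) x0 < e"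
  proof (rule R2.recurrent_extraction[of Y G "var_words1 \<alpha> k \<upsilon>" "words1 \<alpha> k" "subst1 \<alpha> \<upsilon>" ws P I T U])
    show "subst1 \<alpha> \<upsilon> (ws j) p \<in> words1 \<alpha> k" if "1 \<le> n" "n \<le> j" "p \<in> P n" for n j p
      using subst1_words1[OF mono ws that(1,2)] that(3) by (auto simp: P_def)
    show "T i w1 (T i w2 y) = T i (w1 ++ w2) y"
      if "i \<in> I" "w1 \<in> words1 \<alpha> k" "w2 \<in> words1 \<alpha> k" "less_R2 w1 w2" "y \<in> Y" for i w1 w2 y
      using T(1)[OF that(1)] that \<open>Y \<subseteq> X\<close> unfolding system1_def by blast
    show "ws n \<in> var_words1 \<alpha> k \<upsilon> \<and> less_R2 (ws n) (ws (Suc n))" if "n \<ge> 1" for n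
      using ws that by (simp add: var_seqs1_def)
    show "T i w \<in> G" if "i \<in> I" "w \<in> words1 \<alpha> k" for i w using T(1) that by blast
    show "dom (subst1 \<alpha> \<upsilon> w p) = dom w" "subst1 \<alpha> \<upsilon> (w ++ u) p = subst1 \<alpha> \<upsilon> w p ++ subst1 \<alpha> \<upsilon> u p" for w u p
      by (simp_all add: subst1_add)
    show "finite (P n)" for n by (simp add: P_def)
    show "w ++ u \<in> var_words1 \<alpha> k \<upsilon>" if "w \<in> var_words1 \<alpha> k \<upsilon>" "u \<in> var_words1 \<alpha> k \<upsilon>" for w u
      using that by (rule var_words1_add)
    show "w ++ u \<in> words1 \<alpha> k" if "w \<in> words1 \<alpha> k" "u \<in> words1 \<alpha> k" for w u
      using that by (rule words1_add)
    show "var_words1 \<alpha> k \<upsilon> \<subseteq> finite_words" "words1 \<alpha> k \<subseteq> finite_words"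
      by (rule finite_words_supersets)+
    show "minimal_comm_action Y G" "finite I" "open U" "U \<inter> Y \<noteq> {}" by fact+
  qed (rule that)
  have usV1: "us n \<in> var_words1 \<alpha> k \<upsilon>" if "n \<ge> 1" for n using usV that by blast
  have "us n \<in> var_extr1 \<alpha> k \<upsilon> ws" if "n \<ge> 1" for n
    unfolding var_extr1_def mem_Collect_eq
  proof (intro exI conjI)
    show "us n = star_list (map (\<lambda>j. inst1 \<alpha> \<upsilon> (ws j) (Map.empty j)) (D n))"
      by (simp add: us inst1_def)
    show "\<exists>j\<in>set (D n). Map.empty j = None" using D(1)[of n] by (cases "D n") auto
  qed (use D(1-3)[of n] that in auto)
  then have "extraction1 \<alpha> k \<upsilon> us ws"
    using usV by (simp add: extraction1_def var_seqs1_def)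
  moreover have "R2_lim (extr1 \<alpha> k \<upsilon> us) (\<lambda>w. T i w x0) x0" if "i \<in> I" for i
    unfolding R2_lim_def
  proof (intro allI impI)
    fix V assume "open V \<and> x0 \<in> V"
    then obtain e where e: "e > 0" "\<And>x. dist x x0 < e \<Longrightarrow> x \<in> V" by (metis open_dist)
    obtain N where N: "\<And>ns p. ns \<noteq> [] \<Longrightarrow> sorted_wrt (<) ns \<Longrightarrow> set ns \<subseteq> {1..} \<inter> {N..} \<Longrightarrow> \<forall>n\<in>set ns. p n \<in> P n \<Longrightarrow>
       dist (T i (star_list (map (\<lambda>n. subst1 \<alpha> \<upsilon> (us n) (p n)) ns)) x0) x0 < e"
      using lim[OF e(1)] \<open>i \<in> I\<close> by metis
    have "\<exists>a. a \<in> dom (us j)" if "j \<ge> 1" for j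
      by (rule finite_words_nonempty[OF subsetD[OF finite_words_supersets(4) usV1[OF that]]])
    then obtain a where a: "\<And>j. j \<ge> 1 \<Longrightarrow> a j \<in> dom (us j)" by metis
    \<comment> \<open>Using some \<open>us j\<close> with \<open>j < N\<close> would put
      \<open>a j\<close> into the domain and its minimum below \<open>n0\<close>.\<close>
    define n0 where "n0 = Suc (nat (Max (a ` {..N})))"
    have n0: "a j < int n0" if "j < N" for j
    proof -
      have "a j \<le> Max (a ` {..N})" using that by (intro Max_ge) auto
      then show ?thesis by (simp add: n0_def)
    qed
    have "T i w x0 \<in> V" if w: "w \<in> extr1 \<alpha> k \<upsilon> us" and min: "int n0 \<le> Min (dom w)" for w
    proof -
      obtain ns p where w: "w = star_list (map (\<lambda>j. subst1 \<alpha> \<upsilon> (us j) (p j)) ns)"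
        and ns: "ns \<noteq> []" "sorted_wrt (<) ns" "\<forall>j\<in>set ns. j \<ge> 1 \<and> p j \<in> {1..k (int j)}"
        using w by (auto simp: extr1_def)
      have dom: "dom w = (\<Union>j\<in>set ns. dom (us j))" by (simp add: w dom_star_list)
      have fin: "finite (dom w)"
        unfolding dom using ns(3) usV1 by (auto simp: var_words1_def var_words_def)
      have "j \<ge> N" if "j \<in> set ns" for j
      proof (rule ccontr)
        assume "\<not> j \<ge> N"
        moreover have "a j \<in> dom w" using a[of j] ns(3) that dom by auto
        then have "Min (dom w) \<le> a j" using fin by simp
        ultimately show False using n0[of j] min by simp
      qed
      then have "dist (T i (star_list (map (\<lambda>n. subst1 \<alpha> \<upsilon> (us n) (p n)) ns)) x0) x0 < e"
        using ns by (intro N) (auto simp: P_def)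
      then show ?thesis using e(2) by (simp add: w)
    qed
    moreover have "n0 \<ge> 1" by (simp add: n0_def)
    ultimately show "\<exists>n0\<ge>1. \<forall>w\<in>extr1 \<alpha> k \<upsilon> us. int n0 \<le> Min (dom w) \<longrightarrow> T i w x0 \<in> V"
      by blast
  qed
  ultimately show thesis using that x0 by blast
qed

section \<open>Existence and density of recurrent points\<close>

lemma subset_closureI:
  assumes "\<And>U. open U \<Longrightarrow> U \<inter> X \<noteq> {} \<Longrightarrow> U \<inter> S \<noteq> {}"
  shows "X \<subseteq> closure S"
proof (rule ccontr)
  assume "\<not> X \<subseteq> closure S"
  then have "(- closure S) \<inter> X \<noteq> {}" by blast
  then have "(- closure S) \<inter> S \<noteq> {}" by (intro assms) auto
  then show False using closure_subset by blast
qed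

theorem theorem2p15:
  fixes \<alpha> :: "int \<Rightarrow> 'a" and \<upsilon> :: 'a and k :: "int \<Rightarrow> nat"
    and X :: "'x::metric_space set" and G :: "('x \<Rightarrow> 'x) set" and m :: nat
  assumes "\<upsilon> \<notin> \<alpha> ` {n. n \<noteq> 0}"
    and "\<forall>n. n \<noteq> 0 \<longrightarrow> k n \<ge> 1"
    and "mono_on {1..} k"
    and "mono_on {1..} (\<lambda>n. k (- n))"
    and "X \<noteq> {}" and "compact X"
    and "m \<ge> 1"
    and "comm_homeo_group X G"
  shows
    "(\<forall>T ws.
        (\<forall>i\<in>{1..m}. system2 \<alpha> k X (T i) \<and> (\<forall>w\<in>words2 \<alpha> k. T i w \<in> G)) \<and>
        ws \<in> var_seqs2 \<alpha> k \<upsilon> \<longrightarrow>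
        (\<exists>x0\<in>X. \<exists>us. extraction2 \<alpha> k \<upsilon> us ws \<and>
           (\<forall>i\<in>{1..m}. R1_lim (extr2 \<alpha> k \<upsilon> us) (\<lambda>w. T i w x0) x0)) \<and>
        (minimal_action X G \<longrightarrow>
           X \<subseteq> closure {x0 \<in> X. \<exists>us. extraction2 \<alpha> k \<upsilon> us ws \<and>
             (\<forall>i\<in>{1..m}. R1_lim (extr2 \<alpha> k \<upsilon> us) (\<lambda>w. T i w x0) x0)})) \<and>
     (\<forall>T ws.
        (\<forall>i\<in>{1..m}. system1 \<alpha> k X (T i) \<and> (\<forall>w\<in>words1 \<alpha> k. T i w \<in> G)) \<and>
        ws \<in> var_seqs1 \<alpha> k \<upsilon> \<longrightarrow>
        (\<exists>x0\<in>X. \<exists>us. extraction1 \<alpha> k \<upsilon> us ws \<and>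
           (\<forall>i\<in>{1..m}. R2_lim (extr1 \<alpha> k \<upsilon> us) (\<lambda>w. T i w x0) x0)) \<and>
        (minimal_action X G \<longrightarrow>
           X \<subseteq> closure {x0 \<in> X. \<exists>us. extraction1 \<alpha> k \<upsilon> us ws \<and>
             (\<forall>i\<in>{1..m}. R2_lim (extr1 \<alpha> k \<upsilon> us) (\<lambda>w. T i w x0) x0)}))"
proof -
  have inv: "g ` X \<subseteq> X" if "g \<in> G" for g
    using assms(8) that by (metis comm_homeo_group_def homeomorphism_image1 order.refl)
  obtain Y where Y: "Y \<subseteq> X" "compact Y" "Y \<noteq> {}" "\<And>g. g \<in> G \<Longrightarrow> g ` Y \<subseteq> Y"
    "\<And>C. closed C \<Longrightarrow> C \<noteq> {} \<Longrightarrow> C \<subseteq> Y \<Longrightarrow> (\<And>g. g \<in> G \<Longrightarrow> g ` C \<subseteq> C) \<Longrightarrow> C = Y"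
    using exists_minimal_invariant[OF assms(6,5) inv] by metis
  have actY: "minimal_comm_action Y G"
    by (rule minimal_comm_actionI[OF assms(8) Y])
  \<comment> \<open>In the minimal case \<open>X\<close> itself replaces the minimal subset, so
    every open set meeting \<open>X\<close> can be prescribed.\<close>
  have actX: "minimal_comm_action X G" if "minimal_action X G"
  proof (rule minimal_comm_actionI[OF assms(8) order.refl assms(6,5) inv])
    show "C = X" if "closed C" "C \<noteq> {}" "C \<subseteq> X" "\<And>g. g \<in> G \<Longrightarrow> g ` C \<subseteq> C" for C
      using \<open>minimal_action X G\<close> that closed_subset[OF that(3,1)] unfolding minimal_action_def by blast
  qed
  \<comment> \<open>\<open>Z\<close> and \<open>U\<close> stay arbitrary: \<open>Y\<close> with
    \<open>UNIV\<close> gives existence, \<open>X\<close> with any open set meeting it gives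
    density.\<close>
  have 2: "\<exists>x0\<in>U \<inter> Z. \<exists>us. extraction2 \<alpha> k \<upsilon> us ws \<and>
      (\<forall>i\<in>{1..m}. R1_lim (extr2 \<alpha> k \<upsilon> us) (\<lambda>w. T i w x0) x0)"
    if T: "\<forall>i\<in>{1..m}. system2 \<alpha> k X (T i) \<and> (\<forall>w\<in>words2 \<alpha> k. T i w \<in> G)" and ws: "ws \<in> var_seqs2 \<alpha> k \<upsilon>"
      and Z: "minimal_comm_action Z G" "Z \<subseteq> X" and U: "open U" "U \<inter> Z \<noteq> {}" for T ws U Z
    by (rule recurrent_extraction2[where I = "{1..m}", OF assms(3,4) Z bspec[OF T] _ ws U]) auto
  have 1: "\<exists>x0\<in>U \<inter> Z. \<exists>us. extraction1 \<alpha> k \<upsilon> us ws \<and>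
      (\<forall>i\<in>{1..m}. R2_lim (extr1 \<alpha> k \<upsilon> us) (\<lambda>w. T i w x0) x0)"
    if T: "\<forall>i\<in>{1..m}. system1 \<alpha> k X (T i) \<and> (\<forall>w\<in>words1 \<alpha> k. T i w \<in> G)" and ws: "ws \<in> var_seqs1 \<alpha> k \<upsilon>"
      and Z: "minimal_comm_action Z G" "Z \<subseteq> X" and U: "open U" "U \<inter> Z \<noteq> {}" for T ws U Z
    by (rule recurrent_extraction1[where I = "{1..m}", OF assms(3) Z bspec[OF T] _ ws U]) auto
  have "UNIV \<inter> Y \<noteq> {}" using Y(3) by simp
  show ?thesis
  proof (intro conjI allI impI; elim conjE)
    fix T ws
    assume T: "\<forall>i\<in>{1..m}. system2 \<alpha> k X (T i) \<and> (\<forall>w\<in>words2 \<alpha> k. T i w \<in> G)" and ws: "ws \<in> var_seqs2 \<alpha> k \<upsilon>"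
    show "\<exists>x0\<in>X. \<exists>us. extraction2 \<alpha> k \<upsilon> us ws \<and> (\<forall>i\<in>{1..m}. R1_lim (extr2 \<alpha> k \<upsilon> us) (\<lambda>w. T i w x0) x0)"
      using 2[OF T ws actY Y(1) open_UNIV \<open>UNIV \<inter> Y \<noteq> {}\<close>] Y(1) by blast
    show "X \<subseteq> closure {x0 \<in> X. \<exists>us. extraction2 \<alpha> k \<upsilon> us ws \<and>
        (\<forall>i\<in>{1..m}. R1_lim (extr2 \<alpha> k \<upsilon> us) (\<lambda>w. T i w x0) x0)}" if "minimal_action X G"
    proof (rule subset_closureI)
      fix U :: "'x set" assume "open U" "U \<inter> X \<noteq> {}"
      from 2[OF T ws actX[OF that] order.refl this]
      show "U \<inter> {x0 \<in> X. \<exists>us. extraction2 \<alpha> k \<upsilon> us ws \<and>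
        (\<forall>i\<in>{1..m}. R1_lim (extr2 \<alpha> k \<upsilon> us) (\<lambda>w. T i w x0) x0)} \<noteq> {}" by blast
    qed
  next
    fix T ws
    assume T: "\<forall>i\<in>{1..m}. system1 \<alpha> k X (T i) \<and> (\<forall>w\<in>words1 \<alpha> k. T i w \<in> G)" and ws: "ws \<in> var_seqs1 \<alpha> k \<upsilon>"
    show "\<exists>x0\<in>X. \<exists>us. extraction1 \<alpha> k \<upsilon> us ws \<and> (\<forall>i\<in>{1..m}. R2_lim (extr1 \<alpha> k \<upsilon> us) (\<lambda>w. T i w x0) x0)"
      using 1[OF T ws actY Y(1) open_UNIV \<open>UNIV \<inter> Y \<noteq> {}\<close>] Y(1) by blast
    show "X \<subseteq> closure {x0 \<in> X. \<exists>us. extraction1 \<alpha> k \<upsilon> us ws \<and>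
        (\<forall>i\<in>{1..m}. R2_lim (extr1 \<alpha> k \<upsilon> us) (\<lambda>w. T i w x0) x0)}" if "minimal_action X G"
    proof (rule subset_closureI)
      fix U :: "'x set" assume "open U" "U \<inter> X \<noteq> {}"
      from 1[OF T ws actX[OF that] order.refl this]
      show "U \<inter> {x0 \<in> X. \<exists>us. extraction1 \<alpha> k \<upsilon> us ws \<and>
        (\<forall>i\<in>{1..m}. R2_lim (extr1 \<alpha> k \<upsilon> us) (\<lambda>w. T i w x0) x0)} \<noteq> {}" by blast
    qed
  qed
qed

end
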